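(* Let $\mathcal H$, $\mathcal W\subset\mathcal H$, $\mathcal K\subset\mathcal H$, $\mathcal F:\mathcal W\to\mathbb{R}$ and $\nabla\mathcal F:\mathcal W\to\mathcal H$ be as in the context. Let $\mathcal S\subset\mathcal W\cap\mathcal K$ be a subset of the set of critical points of $\mathcal F$ in $\mathcal K$, let $\varphi\in\mathcal S$ and $\mathcal S_\varphi:=\{\psi\in\mathcal S:\mathcal F(\psi)=\mathcal F(\varphi)\}$. Suppose that there is a neighborhood of $\mathcal S_\varphi$ where: (a) the flow of $-\nabla\mathcal F$ in $\mathcal K$ depends continuously on the initial datum; (b) $\mathcal F$ has the constrained Łojasiewicz property on $\mathcal S_\varphi$, with exponent $\gamma\in\,]0,\frac12]$. Then there are constants $\delta>0$, $E>0$ and $C>0$ such that: if $u_0\in\mathcal K\cap\mathcal W$ and $u(t)$ is a global solution of the parabolic variational inequality with initial datum $u_0$ satisfying $$\mathrm{dist}(u_0,\mathcal S_\varphi)\le\delta,\qquad\mathcal F(u_0)-\mathcal F(\mathcal S_\varphi)\le E,\qquad\mathcal F(u(t))>\mathcal F(\mathcal S_\varphi)\ \text{ for every }t>0,$$ then there is $u_\infty\in\mathcal W\cap\mathcal K$ such that $u(t)$ converges to $u_\infty$ as $t\to\infty$ and, if $\gamma<\frac12$, then $$\|u(t)-u_\infty\|\le C\,t^{-\frac{\gamma}{1-2\gamma}}\qquad\text{and}\qquad\mathcal F(u(t))-\mathcal F(\mathcal S_\varphi)\le C\,t^{-\frac{1}{1-2\gamma}}\qquad\text{for every }t\ge1,$$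 while if $\gamma=\frac12$, then $$\|u(t)-u_\infty\|\le e^{-Ct}\qquad\text{and}\qquad\mathcal F(u(t))-\mathcal F(\mathcal S_\varphi)\le e^{-Ct}\qquad\text{for every }t\ge1.$$
   Context: Setting. $\mathcal H$ is a Hilbert space with scalar product $u\cdot v=\langle u,v\rangle$ and norm $\|\cdot\|$; $\mathcal W\subset\mathcal H$ is a linear subspace, carrying its own norm with continuous inclusion in $\mathcal H$ (as for $\mathcal H=L^2$, $\mathcal W=H^2$); $\mathcal F:\mathcal W\to\mathbb{R}$ and $\nabla\mathcal F:\mathcal W\to\mathcal H$ are continuous (possibly non-linear) and satisfy $\mathcal F(u+tv)=\mathcal F(u)+t\,v\cdot\nabla\mathcal F(u)+o(t)$ as $t\to0$, for all $u,v\in\mathcal W$; $\mathcal K\subset\mathcal H$ is convex and $\mathcal K\cap\mathcal W$ is dense in $\mathcal K$. For $u\in\mathcal K\cap\mathcal W$, $$\|\nabla\mathcal F(u)\|_{\mathcal K}:=\sup\Big\{0,\ \sup_{v\in\mathcal K\setminus\{u\}}\frac{-(v-u)\cdot\nabla\mathcal F(u)}{\|v-u\|}\Big\}.$$ $u\in\mathcal K\cap\mathcal W$ is a critical point of $\mathcal F$ in $\mathcal K$ if $(v-u)\cdot\nabla\mathcal F(u)\ge0$ for every $v\in\mathcal K$. Strong solutions. Let $u_0\in\mathcal K$, $T\in\,]0,\infty]$. $u:[0,T[\,\to\mathcal K$ is a (strong) solution of the parabolic variational inequality (flow of $-\nabla\mathcal F$ in $\mathcal K$) with initial datum $u_0$,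 global if $T=+\infty$, if: $u\in C([0,T[\,;\mathcal H)$ and $u(0)=u_0$; $u\in H^1_{loc}(]0,T[\,;\mathcal H)$; $u\in C(]0,T[\,;\mathcal W\cap\mathcal K)$; and for every $v\in\mathcal K$ and almost every $t\in\,]0,T[$, $\langle u'(t)+\nabla\mathcal F(u(t)),v-u(t)\rangle\ge0$. Continuity with respect to the initial datum. The flow depends continuously on the initial datum if for every $t>0$ and $\varepsilon>0$ there is $\delta>0$ such that: if $u_0,v_0\in\mathcal K$ satisfy $\|u_0-v_0\|\le\delta$, then the solutions $u,v$ with initial data $u_0,v_0$ satisfy $\|u(s)-v(s)\|\le\varepsilon$ for every $s\in[0,t]$ for which both flows are defined. (In a neighborhood: the same for $u_0,v_0$ in that neighborhood.) Constrained Łojasiewicz property. $\mathcal F$ has the constrained Łojasiewicz property on a set $\mathcal S'$ of critical points if there are $\gamma\in\,]0,\frac12]$, $C_L>0$, $\delta_L>0$, $E_L>0$ depending on $\mathcal S'$ such that for every $\psi\in\mathcal S'$ $$(\mathcal F(u)-\mathcal F(\psi))_+^{1-\gamma}\le C_L\|\nabla\mathcal F(u)\|_{\mathcal K}$$ for every $u\in\mathcal K\cap\mathcal W$ with $\|u-\psi\|\le\delta_L$ and $\mathcal F(u)-\mathcal F(\psi)\le E_L$. Notation. $\mathcal F(\mathcal S_\varphi):=\mathcal F(\varphi)$; $\mathrm{dist}(u,\mathcal S_\varphi)=\inf_{\psi\in\mathcal S_\varphi}\|u-\psi\|$; a neighborhood of $\mathcal S_\varphi$ (in $\mathcal K$)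 is a set containing $\{u\in\mathcal K:\mathrm{dist}(u,\mathcal S_\varphi)<\delta'\}$ for some $\delta'>0$.
   Formalization: The formal theorem also assumes that K is closed, that solutions exist locally for every initial datum in the neighborhood in (a), and that the global solution satisfies F(u(t)) ≤ F(u_0) for t>0; without such conditions the claim fails. *)

theory Defs
  imports "HOL-Analysis.Analysis"
begin

text \<open>The subspace \<open>W\<close> is a set carrying its own norm \<open>nW\<close>; only the values of \<open>nW\<close> on \<open>W\<close>
  matter. The metric is cut off outside \<open>W\<close> because the locale \<open>Metric_space\<close> wants
  non-negativity and symmetry on the whole type.\<close>

definition norm_on :: "'h::real_vector set \<Rightarrow> ('h \<Rightarrow> real) \<Rightarrow> bool" where
  "norm_on W nW \<longleftrightarrow>
     (\<forall>u\<in>W. 0 \<le> nW u \<and> (nW u = 0 \<longleftrightarrow> u = 0)) \<and>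
     (\<forall>c. \<forall>u\<in>W. nW (c *\<^sub>R u) = \<bar>c\<bar> * nW u) \<and>
     (\<forall>u\<in>W. \<forall>v\<in>W. nW (u + v) \<le> nW u + nW v)"

definition W_dist :: "'h::real_vector set \<Rightarrow> ('h \<Rightarrow> real) \<Rightarrow> 'h \<Rightarrow> 'h \<Rightarrow> real" where
  "W_dist W nW u v = (if u \<in> W \<and> v \<in> W then nW (u - v) else 0)"

definition W_topology :: "'h::real_vector set \<Rightarrow> ('h \<Rightarrow> real) \<Rightarrow> 'h topology" where
  "W_topology W nW = Metric_space.mtopology W (W_dist W nW)"

lemma Metric_space_W_dist:
  assumes W: "subspace W" and n: "norm_on W nW"
  shows "Metric_space W (W_dist W nW)"
proof
  have diff: "x - y \<in> W" if "x \<in> W" "y \<in> W" for x y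
    using W that by (rule subspace_diff)
  have pos: "0 \<le> nW u" and zero: "nW u = 0 \<longleftrightarrow> u = 0" if "u \<in> W" for u
    using n that unfolding norm_on_def by blast+
  have scale: "nW (c *\<^sub>R u) = \<bar>c\<bar> * nW u" if "u \<in> W" for c u
    using n that unfolding norm_on_def by blast
  have tri: "nW (u + v) \<le> nW u + nW v" if "u \<in> W" "v \<in> W" for u v
    using n that unfolding norm_on_def by blast
  fix x y z
  show "0 \<le> W_dist W nW x y"
    by (simp add: W_dist_def pos diff)
  show "W_dist W nW x y = W_dist W nW y x"
    using scale[OF diff, of x y "-1"] by (simp add: W_dist_def)
  show "(W_dist W nW x y = 0) = (x = y)" if "x \<in> W" "y \<in> W"
    using that zero[OF diff, of x y] by (simp add: W_dist_def)
  show "W_dist W nW x z \<le> W_dist W nW x y + W_dist W nW y z"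
    if "x \<in> W" "y \<in> W" "z \<in> W"
    using that tri[OF diff diff, of x y y z] by (simp add: W_dist_def)
qed

lemma topspace_W_topology:
  assumes "subspace W" "norm_on W nW"
  shows "topspace (W_topology W nW) = W"
  unfolding W_topology_def
  by (rule Metric_space.topspace_mtopology[OF Metric_space_W_dist[OF assms]])

text \<open>\<open>G\<close> is the gradient of \<open>F\<close>; the derivative at \<open>0\<close> of \<open>t \<mapsto> F (u + t v)\<close> is the expansion
  \<open>F (u + t v) = F u + t (v \<bullet> G u) + o(t)\<close>. No completeness of \<open>W\<close> is required.\<close>

locale constrained_functional =
  fixes W :: "'h::{real_inner,complete_space} set" and nW :: "'h \<Rightarrow> real" and K :: "'h set"
    and F :: "'h \<Rightarrow> real" and G :: "'h \<Rightarrow> 'h"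
  assumes subspace_W: "subspace W"
    and norm_W: "norm_on W nW"
    and continuous_inclusion: "\<exists>c. \<forall>u\<in>W. norm u \<le> c * nW u"
    and continuous_F: "continuous_map (W_topology W nW) euclideanreal F"
    and continuous_G: "continuous_map (W_topology W nW) euclidean G"
    and gradient: "\<lbrakk>u \<in> W; v \<in> W\<rbrakk> \<Longrightarrow>
          ((\<lambda>t. F (u + t *\<^sub>R v)) has_real_derivative (v \<bullet> G u)) (at 0)"
    and convex_K: "convex K"
    and dense_K: "K \<subseteq> closure (K \<inter> W)"

text \<open>The quotients below are bounded by \<open>norm (G u)\<close>, so the real supremum is the true one.\<close>

definition constrained_grad_norm ::
    "'h::real_inner set \<Rightarrow> ('h \<Rightarrow> 'h) \<Rightarrow> 'h \<Rightarrow> real" where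
  "constrained_grad_norm K G u =
     Sup (insert 0 ((\<lambda>v. - ((v - u) \<bullet> G u) / norm (v - u)) ` (K - {u})))"

definition critical_point ::
    "'h::real_inner set \<Rightarrow> 'h set \<Rightarrow> ('h \<Rightarrow> 'h) \<Rightarrow> 'h \<Rightarrow> bool" where
  "critical_point W K G u \<longleftrightarrow> u \<in> K \<inter> W \<and> (\<forall>v\<in>K. 0 \<le> (v - u) \<bullet> G u)"

text \<open>Bochner spaces. The library's Bochner integral needs a second countable range, so strong
  measurability (a.e. limit of simple functions) is spelled out, and the two integrals in the
  integration by parts formula are gauge integrals; both integrands are Bochner integrable, and
  for those the two integrals agree. Test functions are \<open>C\<^sup>1\<close> with compact support in
  the open interval \<open>I\<close>.\<close>

definition L2_loc :: "real set \<Rightarrow> (real \<Rightarrow> 'h::real_normed_vector) \<Rightarrow> bool" where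
  "L2_loc I f \<longleftrightarrow>
     (\<exists>s. (\<forall>n::nat. simple_function lebesgue (s n)) \<and>
          (AE t in lebesgue. t \<in> I \<longrightarrow> (\<lambda>n. s n t) \<longlonglongrightarrow> f t)) \<and>
     (\<forall>a b. {a..b} \<subseteq> I \<longrightarrow> set_integrable lebesgue {a..b} (\<lambda>t. (norm (f t))\<^sup>2))"

definition weak_derivative_on ::
    "real set \<Rightarrow> (real \<Rightarrow> 'h::real_normed_vector) \<Rightarrow> (real \<Rightarrow> 'h) \<Rightarrow> bool" where
  "weak_derivative_on I f g \<longleftrightarrow>
     (\<forall>\<psi> \<psi>' a b. {a..b} \<subseteq> I \<longrightarrow>
        (\<forall>t. (\<psi> has_real_derivative \<psi>' t) (at t)) \<longrightarrow> continuous_on UNIV \<psi>' \<longrightarrow>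
        (\<forall>t. t \<notin> {a..b} \<longrightarrow> \<psi> t = 0) \<longrightarrow>
        (\<exists>J. ((\<lambda>t. \<psi>' t *\<^sub>R f t) has_integral J) {a..b} \<and>
             ((\<lambda>t. \<psi> t *\<^sub>R g t) has_integral (- J)) {a..b}))"

definition H1_loc_with_derivative ::
    "real set \<Rightarrow> (real \<Rightarrow> 'h::real_normed_vector) \<Rightarrow> (real \<Rightarrow> 'h) \<Rightarrow> bool" where
  "H1_loc_with_derivative I f g \<longleftrightarrow> L2_loc I f \<and> L2_loc I g \<and> weak_derivative_on I f g"

text \<open>Only the values of \<open>u\<close> on \<open>[0,T[\<close> matter.\<close>

definition strong_solution ::
    "'h::{real_inner,complete_space} set \<Rightarrow> ('h \<Rightarrow> real) \<Rightarrow> 'h set \<Rightarrow> ('h \<Rightarrow> 'h) \<Rightarrow>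
     'h \<Rightarrow> ereal \<Rightarrow> (real \<Rightarrow> 'h) \<Rightarrow> bool" where
  "strong_solution W nW K G u0 T u \<longleftrightarrow>
     0 < T \<and> u0 \<in> K \<and>
     (\<forall>t. 0 \<le> t \<and> ereal t < T \<longrightarrow> u t \<in> K) \<and>
     continuous_on {t. 0 \<le> t \<and> ereal t < T} u \<and> u 0 = u0 \<and>
     continuous_map (top_of_set {t. 0 < t \<and> ereal t < T})
       (subtopology (W_topology W nW) (W \<inter> K)) u \<and>
     (\<exists>u'. H1_loc_with_derivative {t. 0 < t \<and> ereal t < T} u u' \<and>
           (\<forall>v\<in>K. AE t in lebesgue. 0 < t \<and> ereal t < T \<longrightarrow>
                0 \<le> (u' t + G (u t)) \<bullet> (v - u t)))"

definition neighborhood_in ::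
    "'h::metric_space set \<Rightarrow> 'h set \<Rightarrow> 'h set \<Rightarrow> bool" where
  "neighborhood_in K S N \<longleftrightarrow> (\<exists>d>0. {u \<in> K. infdist u S < d} \<subseteq> N)"

text \<open>Speaking of \<^emph>\<open>the\<close> solutions with data \<open>u0\<close>, \<open>v0\<close> presupposes that there are any: the
  first conjunct asks for local existence (with no lower bound on the life span). Uniqueness is
  the case \<open>u0 = v0\<close> of the second conjunct.\<close>

definition flow_depends_continuously_on ::
    "'h::{real_inner,complete_space} set \<Rightarrow> ('h \<Rightarrow> real) \<Rightarrow> 'h set \<Rightarrow> ('h \<Rightarrow> 'h) \<Rightarrow>
     'h set \<Rightarrow> bool" where
  "flow_depends_continuously_on W nW K G N \<longleftrightarrow>
     (\<forall>u0\<in>N \<inter> K. \<exists>T u. strong_solution W nW K G u0 T u) \<and>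
     (\<forall>t>0. \<forall>\<epsilon>>0. \<exists>\<delta>>0. \<forall>u0\<in>N \<inter> K. \<forall>v0\<in>N \<inter> K. norm (u0 - v0) \<le> \<delta> \<longrightarrow>
        (\<forall>T1 u T2 v. strong_solution W nW K G u0 T1 u \<longrightarrow> strong_solution W nW K G v0 T2 v \<longrightarrow>
           (\<forall>s\<in>{0..t}. ereal s < T1 \<longrightarrow> ereal s < T2 \<longrightarrow> norm (u s - v s) \<le> \<epsilon>)))"

definition constrained_Lojasiewicz ::
    "'h::real_inner set \<Rightarrow> 'h set \<Rightarrow> ('h \<Rightarrow> real) \<Rightarrow> ('h \<Rightarrow> 'h) \<Rightarrow> 'h set \<Rightarrow> real \<Rightarrow> bool" where
  "constrained_Lojasiewicz W K F G S \<gamma> \<longleftrightarrow>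
     0 < \<gamma> \<and> \<gamma> \<le> 1/2 \<and>
     (\<exists>C>0. \<exists>\<delta>>0. \<exists>E>0. \<forall>\<psi>\<in>S. \<forall>u\<in>K \<inter> W.
        norm (u - \<psi>) \<le> \<delta> \<longrightarrow> F u - F \<psi> \<le> E \<longrightarrow>
        max 0 (F u - F \<psi>) powr (1 - \<gamma>) \<le> C * constrained_grad_norm K G u)"

end

theory Submission
  imports Defs
begin

text \<open>Write \<open>f t = F (u t) - F \<phi>\<close>. Along a solution the energy formally dissipates at the rate
  \<open>- f' = (norm u')\<^sup>2\<close>, and the speed \<open>norm u'\<close> is at least the constrained slope, which by the
  Lojasiewicz inequality is at least \<open>f powr (1 - \<gamma>) / C\<close>. Hence \<open>- (f powr \<gamma>)'\<close> dominates a
  multiple of the speed, so the remaining length of the trajectory is at most a multiple of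
  \<open>f powr \<gamma>\<close>; and \<open>- f'\<close> dominates a multiple of \<open>f powr (2 - 2 * \<gamma>)\<close>, which gives
  polynomial decay of \<open>f\<close> for \<open>\<gamma> < 1/2\<close> and exponential decay for \<open>\<gamma> = 1/2\<close>. If the
  initial energy is small, the length bound keeps the trajectory in the ball where the Lojasiewicz
  inequality holds, so these estimates are valid for all times and yield convergence with rates. The
  limit lies in \<open>W\<close> because, by continuous dependence on initial data, it is a rest point of the flow.

  The formal computation is made rigorous without differentiating the curve almost everywhere, which in
  a general Hilbert space would call for vector-valued Lebesgue theory. The variational inequality
  is first integrated, for each fixed \<open>v\<close>, to a bound on the increments of the squared distance to
  \<open>v\<close> (\<open>strong_solution_imp_evi_trajectory\<close>). That bound has a continuous integrand and holds
  on every interval of positive times. Suitable choices of \<open>v\<close> then give local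
  Lipschitz continuity, the lower bound of the speed by the slope (\<open>speed_ge_slope\<close>), and the
  dissipation estimate \<open>energy_drop_ge_slope_times_displacement\<close>, in which difference quotients of
  step \<open>h\<close> take the place of the derivative. All these estimates are local in time; they pass to long
  intervals because they compare quantities that add up over adjacent intervals (\<open>Bolzano\<close>). The
  integrated Lojasiewicz estimates are \<open>Lojasiewicz_estimates\<close>, \<open>stays_in_ball\<close> and
  \<open>energy_decay\<close>.\<close>


section \<open>Weak derivatives and increments of a curve\<close>

lemma has_real_derivative_max_square:
  "((\<lambda>x::real. (max 0 x)\<^sup>2) has_real_derivative 2 * max 0 x) (at x)"
proof (cases "x = 0")
  case False
  then consider "x > 0" | "x < 0" by linarith
  then show ?thesis
  proof cases
    case 1
    have "((\<lambda>x::real. x\<^sup>2) has_real_derivative 2 * x) (at x)"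
      by (auto intro!: derivative_eq_intros)
    then have "((\<lambda>x::real. (max 0 x)\<^sup>2) has_real_derivative 2 * x) (at x)"
      by (rule has_field_derivative_transform_within_open[where S="{0<..}"]) (use 1 in auto)
    with 1 show ?thesis by simp
  next
    case 2
    have "((\<lambda>x::real. 0) has_real_derivative 0) (at x)" by simp
    then have "((\<lambda>x::real. (max 0 x)\<^sup>2) has_real_derivative 0) (at x)"
      by (rule has_field_derivative_transform_within_open[where S="{..<0}"]) (use 2 in auto)
    with 2 show ?thesis by simp
  qed
next
  case True
  have "((\<lambda>h::real. (max 0 h)\<^sup>2 / h) \<longlongrightarrow> 0) (at 0)"
  proof (rule Lim_null_comparison)
    show "\<forall>\<^sub>F h in at (0::real). norm ((max 0 h)\<^sup>2 / h) \<le> \<bar>h\<bar>"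
      by (rule always_eventually) (auto simp: max_def power2_eq_square)
    show "((\<lambda>h::real. \<bar>h\<bar>) \<longlongrightarrow> 0) (at 0)"
      by (intro tendsto_rabs_zero tendsto_ident_at)
  qed
  then show ?thesis using True by (simp add: DERIV_def)
qed

text \<open>A quadratic spline that rises from \<open>0\<close> to \<open>1\<close> on \<open>[0,1]\<close>; its derivative is the
  piecewise linear hat below. Differences of two rescaled translates are compactly supported
  \<open>C\<^sup>1\<close> test functions approximating the indicator of an interval.\<close>
definition C1_step :: "real \<Rightarrow> real" where
  "C1_step x = 2 * (max 0 x)\<^sup>2 - 4 * (max 0 (x - 1/2))\<^sup>2 + 2 * (max 0 (x - 1))\<^sup>2"

definition hat :: "real \<Rightarrow> real" where
  "hat x = 4 * max 0 x - 8 * max 0 (x - 1/2) + 4 * max 0 (x - 1)"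

lemma C1_step_derivative: "(C1_step has_real_derivative hat x) (at x)"
proof -
  have *: "((\<lambda>x::real. (max 0 (x - c))\<^sup>2) has_real_derivative 2 * max 0 (x - c)) (at x)" for c
  proof -
    have "((\<lambda>x. x - c) has_real_derivative 1) (at x)" by (auto intro!: derivative_eq_intros)
    from DERIV_chain2[OF has_real_derivative_max_square this] show ?thesis by simp
  qed
  show ?thesis
    unfolding C1_step_def[abs_def] hat_def
    using DERIV_add[OF DERIV_diff[OF DERIV_cmult[OF *[of 0], of 2] DERIV_cmult[OF *[of "1/2"], of 4]]
        DERIV_cmult[OF *[of 1], of 2]]
    by simp
qed

lemma continuous_hat: "continuous_on S hat"
  unfolding hat_def[abs_def] by (intro continuous_intros)

lemma hat_nonneg: "0 \<le> hat x" and hat_outside: "x \<notin> {0..1} \<Longrightarrow> hat x = 0"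
  unfolding hat_def by (auto simp: max_def)

lemma C1_step_left: "x \<le> 0 \<Longrightarrow> C1_step x = 0"
  unfolding C1_step_def by (auto simp: max_def)

lemma C1_step_right: "1 \<le> x \<Longrightarrow> C1_step x = 1"
  unfolding C1_step_def by (auto simp: max_def power2_eq_square algebra_simps)

lemma C1_step_mono: "x \<le> y \<Longrightarrow> C1_step x \<le> C1_step y"
  by (rule DERIV_nonneg_imp_nondecreasing) (use C1_step_derivative hat_nonneg in blast)+

lemma C1_step_bounds: "0 \<le> C1_step x" "C1_step x \<le> 1"
  using C1_step_mono[of "min 0 x" x] C1_step_mono[of x "max 1 x"]
    C1_step_left[of "min 0 x"] C1_step_right[of "max 1 x"] by auto

lemma scaled_step_derivative:
  assumes "\<delta> > 0"
  shows "((\<lambda>t. C1_step ((t - \<alpha>) / \<delta>)) has_real_derivative hat ((t - \<alpha>) / \<delta>) / \<delta>) (at t)"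
proof -
  have "((\<lambda>t. (t - \<alpha>) / \<delta>) has_real_derivative 1 / \<delta>) (at t)"
    using assms by (auto intro!: derivative_eq_intros)
  from DERIV_chain2[OF C1_step_derivative this] show ?thesis by simp
qed

text \<open>The rescaled hats are nonnegative kernels of mass one concentrating at \<open>\<alpha>\<close> from the right.\<close>
lemma hat_average_tendsto:
  fixes y :: "real \<Rightarrow> real"
  assumes y: "continuous_on {a..b} y" and \<alpha>: "a \<le> \<alpha>" and \<delta>: "\<And>n. \<delta> n > 0" "\<And>n. \<alpha> + \<delta> n \<le> b"
    and lim: "\<delta> \<longlonglongrightarrow> 0"
  shows "(\<lambda>n. integral {a..b} (\<lambda>t. hat ((t - \<alpha>) / \<delta> n) / \<delta> n * y t)) \<longlonglongrightarrow> y \<alpha>"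
proof (rule LIMSEQ_I)
  fix e :: real assume e: "e > 0"
  have ab: "a \<le> b" "\<alpha> \<in> {a..b}" using \<alpha> \<delta>[of 0] by auto
  obtain d where d: "d > 0" "\<And>t. t \<in> {a..b} \<Longrightarrow> dist t \<alpha> < d \<Longrightarrow> dist (y t) (y \<alpha>) < e / 2"
    using y e ab(2) unfolding continuous_on_iff by (meson half_gt_zero)
  obtain n0 where n0: "\<And>n. n \<ge> n0 \<Longrightarrow> \<delta> n < d"
    using lim d(1) \<delta>(1) unfolding LIMSEQ_def by (metis abs_of_pos dist_0_norm dist_commute real_norm_def)
  show "\<exists>n0. \<forall>n\<ge>n0. norm (integral {a..b} (\<lambda>t. hat ((t - \<alpha>) / \<delta> n) / \<delta> n * y t) - y \<alpha>) < e"
  proof (intro exI allI impI)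
    fix n assume n: "n \<ge> n0"
    define k where "k t = hat ((t - \<alpha>) / \<delta> n) / \<delta> n" for t
    have k0: "0 \<le> k t" for t unfolding k_def using hat_nonneg \<delta>(1)[of n] by (simp add: divide_nonneg_pos)
    have kc: "continuous_on {a..b} k"
      unfolding k_def by (intro continuous_intros continuous_on_compose2[OF continuous_hat[of UNIV]])
        (use \<delta>(1)[of n] in auto)
    have "(k has_integral C1_step ((b - \<alpha>) / \<delta> n) - C1_step ((a - \<alpha>) / \<delta> n)) {a..b}"
      unfolding k_def
      by (rule fundamental_theorem_of_calculus[OF ab(1)])
        (use scaled_step_derivative[OF \<delta>(1)[of n]] in
          \<open>auto simp: has_real_derivative_iff_has_vector_derivative[symmetric] intro: has_field_derivative_at_within\<close>)
    moreover have "C1_step ((b - \<alpha>) / \<delta> n) = 1"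
      by (rule C1_step_right) (use \<delta>[of n] in \<open>simp add: field_simps\<close>)
    moreover have "C1_step ((a - \<alpha>) / \<delta> n) = 0"
      by (rule C1_step_left) (use \<delta>[of n] \<alpha> in \<open>simp add: field_simps\<close>)
    ultimately have k1: "(k has_integral 1) {a..b}" by simp
    have ky: "(\<lambda>t. k t * y t) integrable_on {a..b}"
      by (intro integrable_continuous_real continuous_intros kc y)
    have "((\<lambda>t. k t * y t - k t * y \<alpha>) has_integral integral {a..b} (\<lambda>t. k t * y t) - 1 * y \<alpha>) {a..b}"
      by (intro has_integral_diff integrable_integral ky has_integral_mult_left k1)
    then have eq: "integral {a..b} (\<lambda>t. k t * y t) - y \<alpha> = integral {a..b} (\<lambda>t. k t * y t - k t * y \<alpha>)"
      and int: "(\<lambda>t. k t * y t - k t * y \<alpha>) integrable_on {a..b}"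
      by (auto simp: has_integral_integrable_integral)
    have le: "norm (k t * y t - k t * y \<alpha>) \<le> k t * (e/2)" if t: "t \<in> {a..b}" for t
    proof (cases "(t - \<alpha>) / \<delta> n \<in> {0..1}")
      case True
      then have "dist t \<alpha> < d" using n0[OF n] \<delta>(1)[of n] by (auto simp: dist_real_def field_simps)
      then have "\<bar>y t - y \<alpha>\<bar> \<le> e/2" using d(2)[OF t] by (simp add: dist_real_def)
      then have "k t * \<bar>y t - y \<alpha>\<bar> \<le> k t * (e/2)" using k0 mult_left_mono by blast
      then show ?thesis using k0[of t] by (simp add: abs_mult flip: right_diff_distrib)
    next
      case False
      then show ?thesis using hat_outside unfolding k_def by simp
    qed
    have "((\<lambda>t. k t * (e/2)) has_integral 1 * (e/2)) {a..b}"
      by (rule has_integral_mult_left[OF k1])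
    then have "norm (integral {a..b} (\<lambda>t. k t * y t - k t * y \<alpha>)) \<le> e/2"
      using integral_norm_bound_integral[OF int _ le] by (auto simp: has_integral_integrable_integral)
    then show "norm (integral {a..b} (\<lambda>t. hat ((t - \<alpha>) / \<delta> n) / \<delta> n * y t) - y \<alpha>) < e"
      using eq e unfolding k_def by simp
  qed
qed

text \<open>Testing with a difference of two steps, one starting at \<open>\<alpha>\<close> and one at \<open>\<beta>\<close>, and letting their
  width shrink: the side with \<open>y\<close> tends to the increment of \<open>y\<close> because of the hat kernels, the
  side with \<open>k\<close> to its integral by dominated convergence. The interval extends beyond \<open>\<beta>\<close> to
  leave room for the width of the second step.\<close>
lemma integral_of_scalar_weak_derivative:
  fixes y k :: "real \<Rightarrow> real"
  assumes ab: "\<alpha> < \<beta>" "\<beta> < b" and y: "continuous_on {\<alpha>..b} y" and k: "k absolutely_integrable_on {\<alpha>..b}"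
    and weak: "\<And>\<psi> \<psi>'. (\<And>t. (\<psi> has_real_derivative \<psi>' t) (at t)) \<Longrightarrow> continuous_on UNIV \<psi>' \<Longrightarrow>
        (\<And>t. t \<notin> {\<alpha>..b} \<Longrightarrow> \<psi> t = 0) \<Longrightarrow>
        \<exists>J. ((\<lambda>t. \<psi>' t * y t) has_integral J) {\<alpha>..b} \<and> ((\<lambda>t. \<psi> t * k t) has_integral (- J)) {\<alpha>..b}"
  shows "(k has_integral y \<beta> - y \<alpha>) {\<alpha>..\<beta>}"
proof -
  define \<delta> where "\<delta> n = (b - \<beta>) / real (Suc n)" for n
  have \<delta>0: "\<delta> n > 0" for n using ab by (simp add: \<delta>_def)
  have \<delta>1: "\<delta> n \<le> b - \<beta>" for n using ab by (simp add: \<delta>_def divide_le_eq mult_le_cancel_left1)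
  have \<delta>lim: "\<delta> \<longlonglongrightarrow> 0" unfolding \<delta>_def by (intro LIMSEQ_Suc lim_const_over_n)
  define S where "S n \<gamma> t = C1_step ((t - \<gamma>) / \<delta> n)" for n \<gamma> t
  define H where "H n \<gamma> t = hat ((t - \<gamma>) / \<delta> n) / \<delta> n" for n \<gamma> t
  have Hc: "continuous_on A (H n \<gamma>)" for n \<gamma> A
    unfolding H_def by (intro continuous_intros continuous_on_compose2[OF continuous_hat[of UNIV]])
        (use \<delta>0[of n] in auto)
  have int: "(\<lambda>t. (S n \<alpha> t - S n \<beta> t) * k t) integrable_on {\<alpha>..b}"
    and val: "integral {\<alpha>..b} (\<lambda>t. (S n \<alpha> t - S n \<beta> t) * k t)
       = integral {\<alpha>..b} (\<lambda>t. H n \<beta> t * y t) - integral {\<alpha>..b} (\<lambda>t. H n \<alpha> t * y t)" for n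
  proof -
    have 1: "((\<lambda>t. S n \<alpha> t - S n \<beta> t) has_real_derivative H n \<alpha> t - H n \<beta> t) (at t)" for t
      unfolding S_def H_def by (intro DERIV_diff scaled_step_derivative \<delta>0)
    have 2: "continuous_on UNIV (\<lambda>t. H n \<alpha> t - H n \<beta> t)" by (intro continuous_intros Hc)
    have 3: "S n \<alpha> t - S n \<beta> t = 0" if t: "t \<notin> {\<alpha>..b}" for t
    proof (cases "t < \<alpha>")
      case True
      then show ?thesis using ab \<delta>0[of n] by (simp add: S_def C1_step_left divide_le_0_iff)
    next
      case False
      then have "t > b" using t by auto
      then have "1 \<le> (t - \<alpha>) / \<delta> n" "1 \<le> (t - \<beta>) / \<delta> n"
        using ab \<delta>1[of n] \<delta>0[of n] by (auto simp: field_simps)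
      then show ?thesis by (simp add: S_def C1_step_right)
    qed
    from weak[OF 1 2 3] obtain J where J: "((\<lambda>t. (H n \<alpha> t - H n \<beta> t) * y t) has_integral J) {\<alpha>..b}"
      "((\<lambda>t. (S n \<alpha> t - S n \<beta> t) * k t) has_integral (- J)) {\<alpha>..b}" by blast
    have i: "(\<lambda>t. H n \<gamma> t * y t) integrable_on {\<alpha>..b}" for \<gamma>
      by (intro integrable_continuous_real continuous_intros Hc y)
    have "J = integral {\<alpha>..b} (\<lambda>t. H n \<alpha> t * y t) - integral {\<alpha>..b} (\<lambda>t. H n \<beta> t * y t)"
      using J(1) integral_diff[OF i[of \<alpha>] i[of \<beta>]] by (simp add: left_diff_distrib integral_unique)
    with J(2) show "(\<lambda>t. (S n \<alpha> t - S n \<beta> t) * k t) integrable_on {\<alpha>..b}"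
      "integral {\<alpha>..b} (\<lambda>t. (S n \<alpha> t - S n \<beta> t) * k t)
       = integral {\<alpha>..b} (\<lambda>t. H n \<beta> t * y t) - integral {\<alpha>..b} (\<lambda>t. H n \<alpha> t * y t)"
      by (auto simp: has_integral_integrable_integral)
  qed
  have lim1: "(\<lambda>n. integral {\<alpha>..b} (\<lambda>t. (S n \<alpha> t - S n \<beta> t) * k t)) \<longlonglongrightarrow> y \<beta> - y \<alpha>"
    unfolding val H_def
    by (intro tendsto_diff hat_average_tendsto y \<delta>0 \<delta>lim) (use ab \<delta>1 in \<open>auto simp: algebra_simps, smt (verit, best)\<close>)
  define g where "g t = (if t \<in> {\<alpha><..\<beta>} then k t else 0)" for t
  have kabs: "(\<lambda>t. \<bar>k t\<bar>) integrable_on {\<alpha>..b}"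
    using k unfolding absolutely_integrable_on_def by simp
  have step: "(\<lambda>n. S n \<gamma> t) \<longlonglongrightarrow> (if t > \<gamma> then 1 else 0)" for \<gamma> t
  proof (cases "t > \<gamma>")
    case True
    then have "\<forall>\<^sub>F n in sequentially. \<delta> n < t - \<gamma>" using \<delta>lim by (intro order_tendstoD) auto
    then have "\<forall>\<^sub>F n in sequentially. S n \<gamma> t = 1"
      by eventually_elim (use \<delta>0 in \<open>auto simp: S_def field_simps intro!: C1_step_right\<close>)
    with True show ?thesis using tendsto_eventually by fastforce
  next
    case False
    then have "S n \<gamma> t = 0" for n using \<delta>0[of n] by (simp add: S_def C1_step_left divide_le_0_iff)
    with False show ?thesis by simp
  qed
  have conv: "(\<lambda>n. (S n \<alpha> t - S n \<beta> t) * k t) \<longlonglongrightarrow> g t" for t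
    using tendsto_mult[OF tendsto_diff[OF step[of \<alpha> t] step[of \<beta> t]] tendsto_const[of "k t"]] ab
    by (auto simp: g_def split: if_splits)
  have dom: "norm ((S n \<alpha> t - S n \<beta> t) * k t) \<le> \<bar>k t\<bar>" for n t
  proof -
    have "\<bar>S n \<alpha> t - S n \<beta> t\<bar> \<le> 1"
      using C1_step_bounds[of "(t-\<alpha>)/\<delta> n"] C1_step_bounds[of "(t-\<beta>)/\<delta> n"] by (simp add: S_def abs_le_iff)
    then show ?thesis by (simp add: abs_mult mult_left_le_one_le)
  qed
  have "g integrable_on {\<alpha>..b}" "(\<lambda>n. integral {\<alpha>..b} (\<lambda>t. (S n \<alpha> t - S n \<beta> t) * k t)) \<longlonglongrightarrow> integral {\<alpha>..b} g"
    by (rule dominated_convergence[OF int kabs dom conv]; assumption)+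
  then have "(g has_integral y \<beta> - y \<alpha>) {\<alpha>..b}"
    using lim1 LIMSEQ_unique by (auto simp: has_integral_integrable_integral)
  then have "((\<lambda>t. if t \<in> {\<alpha>..\<beta>} then k t else 0) has_integral y \<beta> - y \<alpha>) {\<alpha>..b}"
    by (rule has_integral_spike[of "{\<alpha>}", rotated 2]) (auto simp: g_def)
  then show ?thesis
    by (subst (asm) has_integral_restrict) (use ab in auto)
qed

text \<open>All the information taken from the Sobolev regularity: scalar increments are integrals of the
  weak derivative, whose norm is locally integrable. Pairing with a fixed vector \<open>w\<close> reduces the
  vector-valued integration to real functions, so the Hilbert space may be non-separable.\<close>
lemma H1_loc_inner_has_integral:
  fixes u :: "real \<Rightarrow> 'h::real_inner"
  assumes cont: "continuous_on {0<..} u" and H: "H1_loc_with_derivative {0<..} u u'"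
  shows "\<And>w a b. 0 < a \<Longrightarrow> a \<le> b \<Longrightarrow> ((\<lambda>r. u' r \<bullet> w) has_integral (u b - u a) \<bullet> w) {a..b}"
    and "\<And>a b. 0 < a \<Longrightarrow> (\<lambda>r. norm (u' r)) integrable_on {a..b}"
proof -
  have L2: "L2_loc {0<..} u'" and weak: "weak_derivative_on {0<..} u u'"
    using H unfolding H1_loc_with_derivative_def by blast+
  note L2' = L2[unfolded L2_loc_def]
  have sq: "\<And>a b. {a..b} \<subseteq> {0<..} \<Longrightarrow> set_integrable lebesgue {a..b} (\<lambda>t. (norm (u' t))\<^sup>2)"
    using L2'[THEN conjunct2] by simp
  obtain s where "(\<forall>n::nat. simple_function lebesgue (s n)) \<and>
      (AE t in lebesgue. t \<in> {0<..} \<longrightarrow> (\<lambda>n. s n t) \<longlonglongrightarrow> u' t)"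
    by (rule exE[OF L2'[THEN conjunct1]])
  then have s: "\<And>n. simple_function lebesgue (s n)"
    and lim: "AE t in lebesgue. t \<in> {0<..} \<longrightarrow> (\<lambda>n. s n t) \<longlonglongrightarrow> u' t"
    by simp_all
  from lim obtain Z where Z: "negligible Z"
    and Zlim: "\<And>t. t \<notin> Z \<Longrightarrow> t > 0 \<Longrightarrow> (\<lambda>n. s n t) \<longlonglongrightarrow> u' t"
    unfolding eventually_ae_filter_negligible by auto
  \<comment> \<open>Redefining the derivative as \<open>0\<close> off \<open>A\<close> makes it a pointwise limit of simple functions everywhere.\<close>
  define A where "A = {0<..} - Z"
  have A: "A \<in> sets lebesgue"
    unfolding A_def by (rule sets.Diff[OF _ negligible_imp_sets[OF Z]]) simp
  define g where "g t = (if t \<in> A then u' t else 0)" for t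
  have meas: "(\<lambda>t. \<Phi> (g t)) \<in> borel_measurable lebesgue"
    if \<Phi>: "continuous_on UNIV \<Phi>" for \<Phi> :: "'h \<Rightarrow> real"
  proof (rule borel_measurable_LIMSEQ_real)
    show "(\<lambda>n. if t \<in> A then \<Phi> (s n t) else \<Phi> 0) \<longlonglongrightarrow> \<Phi> (g t)" for t
    proof (cases "t \<in> A")
      case True
      then have "(\<lambda>n. s n t) \<longlonglongrightarrow> u' t" using Zlim by (auto simp: A_def)
      then have "(\<lambda>n. \<Phi> (s n t)) \<longlonglongrightarrow> \<Phi> (u' t)"
        using \<Phi> continuous_on_tendsto_compose by fastforce
      with True show ?thesis by (simp add: g_def)
    qed (simp add: g_def)
    have 1: "(\<lambda>t. \<Phi> (s n t)) \<in> borel_measurable lebesgue" for n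
      using simple_function_compose[OF s[of n], of \<Phi>]
      by (intro borel_measurable_simple_function) (simp add: o_def)
    show "(\<lambda>t. if t \<in> A then \<Phi> (s n t) else \<Phi> 0) \<in> borel_measurable lebesgue" for n
      by (rule measurable_If_set[OF 1]) (use A in auto)
  qed
  have sq_g: "(\<lambda>t. (norm (g t))\<^sup>2) integrable_on {a..b}" if "0 < a" for a b
  proof (rule integrable_spike[OF _ Z])
    show "(\<lambda>t. (norm (u' t))\<^sup>2) integrable_on {a..b}"
      by (rule set_lebesgue_integral_eq_integral(1)[OF sq]) (use that in auto)
    show "(norm (g t))\<^sup>2 = (norm (u' t))\<^sup>2" if "t \<in> {a..b} - Z" for t
      using that \<open>0 < a\<close> by (auto simp: g_def A_def)
  qed
  have absint: "(\<lambda>t. \<Phi> (g t)) absolutely_integrable_on {a..b}"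
    if \<Phi>: "continuous_on UNIV \<Phi>" "\<And>x. \<bar>\<Phi> x\<bar> \<le> c * norm x" "0 \<le> c" and a: "0 < a"
    for \<Phi> :: "'h \<Rightarrow> real" and a b c
  proof (rule measurable_bounded_by_integrable_imp_absolutely_integrable)
    show "(\<lambda>t. \<Phi> (g t)) \<in> borel_measurable (lebesgue_on {a..b})"
      by (rule measurable_restrict_space1[OF meas[OF \<Phi>(1)]])
    show "(\<lambda>t. c * (1 + (norm (g t))\<^sup>2)) integrable_on {a..b}"
      by (intro integrable_on_mult_right integrable_add sq_g a) auto
    show "norm (\<Phi> (g t)) \<le> c * (1 + (norm (g t))\<^sup>2)" for t
    proof -
      have "norm (g t) \<le> 1 + (norm (g t))\<^sup>2"
        using zero_le_power2[of "norm (g t) - 1"] by (simp add: power2_diff algebra_simps)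
          (smt (verit) norm_ge_zero)
      then have "c * norm (g t) \<le> c * (1 + (norm (g t))\<^sup>2)" using \<Phi>(3) mult_left_mono by blast
      with \<Phi>(2)[of "g t"] show ?thesis by simp
    qed
  qed auto
  have absint': "(\<lambda>t. \<Phi> (u' t)) absolutely_integrable_on {a..b}"
    if \<Phi>: "continuous_on UNIV \<Phi>" "\<And>x. \<bar>\<Phi> x\<bar> \<le> c * norm x" "0 \<le> c" and a: "0 < a"
    for \<Phi> :: "'h \<Rightarrow> real" and a b c
    by (rule absolutely_integrable_spike[OF absint[OF \<Phi> a] Z])
      (use a in \<open>auto simp: g_def A_def\<close>)
  show "(\<lambda>r. norm (u' r)) integrable_on {a..b}" if "0 < a" for a b
    using absint'[of norm 1 a b] that
    by (intro set_lebesgue_integral_eq_integral(1)) (auto intro: continuous_on_norm_id)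
  show "((\<lambda>r. u' r \<bullet> w) has_integral (u b - u a) \<bullet> w) {a..b}" if ab: "0 < a" "a \<le> b" for w a b
  proof (cases "a = b")
    case True
    then show ?thesis using has_integral_refl(2)[of "\<lambda>r. u' r \<bullet> w" a] by simp
  next
    case False
    have "((\<lambda>r. u' r \<bullet> w) has_integral u b \<bullet> w - u a \<bullet> w) {a..b}"
    proof (rule integral_of_scalar_weak_derivative)
      show "a < b" "b < b + 1" using ab False by auto
      show "continuous_on {a..b + 1} (\<lambda>t. u t \<bullet> w)"
        by (intro continuous_intros continuous_on_subset[OF cont]) (use ab in auto)
      show "(\<lambda>r. u' r \<bullet> w) absolutely_integrable_on {a..b + 1}"
        by (rule absint'[of "\<lambda>x. x \<bullet> w" "norm w"])
          (use ab Cauchy_Schwarz_ineq2 in \<open>auto intro!: continuous_intros simp: mult.commute\<close>)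
      fix \<psi> \<psi>' :: "real \<Rightarrow> real"
      assume \<psi>: "\<And>t. (\<psi> has_real_derivative \<psi>' t) (at t)" "continuous_on UNIV \<psi>'"
        "\<And>t. t \<notin> {a..b + 1} \<Longrightarrow> \<psi> t = 0"
      have "{a..b + 1} \<subseteq> {0<..}" using ab by auto
      with weak \<psi> obtain J where J: "((\<lambda>t. \<psi>' t *\<^sub>R u t) has_integral J) {a..b + 1}"
        "((\<lambda>t. \<psi> t *\<^sub>R u' t) has_integral (- J)) {a..b + 1}"
        unfolding weak_derivative_on_def by blast
      from this[THEN has_integral_linear, OF bounded_linear_inner_left[of w]]
      show "\<exists>J. ((\<lambda>t. \<psi>' t * (u t \<bullet> w)) has_integral J) {a..b + 1} \<and>
          ((\<lambda>t. \<psi> t * (u' t \<bullet> w)) has_integral - J) {a..b + 1}"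
        by (auto simp: o_def)
    qed
    then show ?thesis by (simp add: inner_diff_left)
  qed
qed

section \<open>The evolution variational inequality\<close>

text \<open>The chain rule for half the squared distance to a point \<open>v\<close>, without differentiating the curve.
  On a short interval the increment is exactly the increment of \<open>u\<close> paired with \<open>m - v\<close>, where \<open>m\<close> is
  the midpoint of the two end values, and replacing \<open>m\<close> by \<open>u r\<close> under the integral costs at most
  \<open>e\<close> times the integral of the norm of \<open>u'\<close>. These errors add up over a partition, and \<open>e\<close> is arbitrary.\<close>
lemma half_square_distance_increment_le:
  fixes u u' :: "real \<Rightarrow> 'h::real_inner"
  assumes st: "s \<le> t" and cont: "continuous_on {s..t} u"
    and int: "\<And>w a b. s \<le> a \<Longrightarrow> a \<le> b \<Longrightarrow> b \<le> t \<Longrightarrow> ((\<lambda>r. u' r \<bullet> w) has_integral (u b - u a) \<bullet> w) {a..b}"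
    and nint: "(\<lambda>r. norm (u' r)) integrable_on {s..t}"
    and g: "\<And>r. r \<in> {s..t} \<Longrightarrow> (g has_real_derivative g' r) (at r within {s..t})"
    and Z: "negligible Z" and le: "\<And>r. r \<in> {s..t} - Z \<Longrightarrow> u' r \<bullet> (u r - v) \<le> g' r"
  shows "(norm (u t - v))\<^sup>2 / 2 - (norm (u s - v))\<^sup>2 / 2 \<le> g t - g s"
proof -
  define \<phi> where "\<phi> r = (norm (u r - v))\<^sup>2 / 2" for r
  define N where "N a b = integral {a..b} (\<lambda>r. norm (u' r))" for a b
  have nint': "(\<lambda>r. norm (u' r)) integrable_on {a..b}" if "s \<le> a" "b \<le> t" for a b
    by (rule integrable_on_subinterval[OF nint]) (use that in auto)
  have main: "\<phi> t - \<phi> s \<le> g t - g s + e * N s t" if e: "e > 0" for e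
  proof -
    have "s \<le> s \<longrightarrow> t \<le> t \<longrightarrow> \<phi> t - \<phi> s \<le> g t - g s + e * N s t"
      using st
    proof (induction rule: Bolzano[where P="\<lambda>x y. s \<le> x \<longrightarrow> y \<le> t \<longrightarrow> \<phi> y - \<phi> x \<le> g y - g x + e * N x y"])
      case (trans a b c)
      show ?case
      proof (intro impI)
        assume "s \<le> a" "c \<le> t"
        then have "N a b + N b c = N a c"
          unfolding N_def by (intro Henstock_Kurzweil_Integration.integral_combine nint' trans)
        moreover have "e * (N a b + N b c) = e * N a b + e * N b c" by (simp add: algebra_simps)
        ultimately show "\<phi> c - \<phi> a \<le> g c - g a + e * N a c"
          using trans \<open>s \<le> a\<close> \<open>c \<le> t\<close> by force
      qed
    next
      case (local x)
      then have "x \<in> {s..t}" by simp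
      with cont e obtain d where d: "d > 0" "\<And>r. r \<in> {s..t} \<Longrightarrow> dist r x < d \<Longrightarrow> dist (u r) (u x) < e / 2"
        unfolding continuous_on_iff by (meson half_gt_zero)
      show ?case
      proof (intro exI[of _ d] conjI d allI impI)
        fix a b assume ab: "a \<le> x \<and> x \<le> b \<and> b - a < d" and sa: "s \<le> a" and bt: "b \<le> t"
        then have ab': "a \<le> b" by simp
        define m where "m = (1/2) *\<^sub>R (u a + u b)"
        have near: "norm (m - u r) \<le> e" if r: "r \<in> {a..b}" for r
        proof -
          have *: "norm (u r - u x) < e/2" "norm (u a - u x) < e/2" "norm (u b - u x) < e/2"
            using d(2)[of r] d(2)[of a] d(2)[of b] ab sa bt r by (auto simp: dist_norm)
          have "m - u r = (1/2) *\<^sub>R ((u a - u x) + (u b - u x)) - (u r - u x)"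
            by (simp add: m_def scaleR_add_right scaleR_diff_right algebra_simps flip: scaleR_left_distrib)
          also have "norm \<dots> \<le> (1/2) * norm ((u a - u x) + (u b - u x)) + norm (u r - u x)"
            by (rule order_trans[OF norm_triangle_ineq4]) simp
          finally show ?thesis using * norm_triangle_ineq[of "u a - u x" "u b - u x"] by linarith
        qed
        have incr: "\<phi> b - \<phi> a = (u b - u a) \<bullet> (m - v)"
          by (simp add: \<phi>_def m_def power2_norm_eq_inner inner_diff inner_add inner_commute field_simps)
        have 1: "((\<lambda>r. if r \<in> Z then g' r + e * norm (u' r) else u' r \<bullet> (m - v)) has_integral \<phi> b - \<phi> a) {a..b}"
          unfolding incr by (rule has_integral_spike[OF Z _ int[OF sa ab' bt]]) auto
        have "(g has_real_derivative g' r) (at r within {a..b})" if "r \<in> {a..b}" for r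
          by (rule DERIV_subset[OF g]) (use that sa bt in auto)
        then have "(g' has_integral g b - g a) {a..b}"
          by (intro fundamental_theorem_of_calculus ab')
            (auto simp: has_real_derivative_iff_has_vector_derivative[symmetric])
        then have 2: "((\<lambda>r. g' r + e * norm (u' r)) has_integral g b - g a + e * N a b) {a..b}"
          unfolding N_def
          by (intro has_integral_add has_integral_mult_right integrable_integral nint' sa bt)
        show "\<phi> b - \<phi> a \<le> g b - g a + e * N a b"
        proof (rule has_integral_le[OF 1 2])
          fix r assume r: "r \<in> {a..b}"
          show "(if r \<in> Z then g' r + e * norm (u' r) else u' r \<bullet> (m - v)) \<le> g' r + e * norm (u' r)"
          proof (cases "r \<in> Z")
            case False
            have "u' r \<bullet> (m - v) = u' r \<bullet> (u r - v) + u' r \<bullet> (m - u r)" by (simp add: inner_diff)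
            moreover have "u' r \<bullet> (u r - v) \<le> g' r" using le r sa bt False by auto
            moreover have "u' r \<bullet> (m - u r) \<le> norm (u' r) * e"
              using norm_cauchy_schwarz[of "u' r" "m - u r"] mult_left_mono[OF near[OF r], of "norm (u' r)"]
              by simp
            ultimately show ?thesis using False by (simp add: mult.commute)
          qed simp
        qed
      qed
    qed
    then show ?thesis by simp
  qed
  have N0: "0 \<le> N s t" unfolding N_def by (rule integral_nonneg[OF nint]) simp
  have "\<phi> t - \<phi> s \<le> g t - g s"
  proof (rule field_le_epsilon)
    fix e :: real assume e: "e > 0"
    have "\<phi> t - \<phi> s \<le> g t - g s + e / (N s t + 1) * N s t"
      using N0 e by (intro main) simp
    also have "e / (N s t + 1) * N s t \<le> e" using N0 e by (simp add: field_simps)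
    finally show "\<phi> t - \<phi> s \<le> g t - g s + e" by simp
  qed
  then show ?thesis by (simp add: \<phi>_def)
qed

text \<open>The properties of a strong solution that the energy estimates rely on. The assumption \<open>evi\<close> is
  the evolution variational inequality \<open>d/dt (norm (u - v))\<^sup>2 / 2 \<le> G u \<bullet> (v - u)\<close> in integrated form:
  its right-hand side may be replaced by any derivative that dominates it. It holds
  for each \<open>v\<close> on every interval, so no exceptional null set depends on \<open>v\<close>.\<close>
locale evi_trajectory = constrained_functional W nW K F G
  for W :: "'h::{real_inner,complete_space} set" and nW :: "'h \<Rightarrow> real" and K :: "'h set"
    and F :: "'h \<Rightarrow> real" and G :: "'h \<Rightarrow> 'h" +
  fixes u :: "real \<Rightarrow> 'h"
  assumes in_W: "0 < t \<Longrightarrow> u t \<in> W" and in_K: "0 < t \<Longrightarrow> u t \<in> K"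
    and continuous_in_W: "continuous_map (top_of_set {0<..}) (W_topology W nW) u"
    and evi: "\<lbrakk>v \<in> K; 0 < s; s \<le> t;
        \<And>r. r \<in> {s..t} \<Longrightarrow> (g has_real_derivative g' r) (at r within {s..t});
        \<And>r. r \<in> {s..t} \<Longrightarrow> G (u r) \<bullet> (v - u r) \<le> g' r\<rbrakk>
      \<Longrightarrow> (norm (u t - v))\<^sup>2 / 2 - (norm (u s - v))\<^sup>2 / 2 \<le> g t - g s"

lemma (in constrained_functional) strong_solution_imp_evi_trajectory:
  assumes sol: "strong_solution W nW K G u0 \<infinity> u"
  shows "evi_trajectory W nW K F G u"
proof -
  have pos: "{t::real. 0 < t \<and> ereal t < \<infinity>} = {0<..}" by auto
  have cm: "continuous_map (top_of_set {0<..}) (subtopology (W_topology W nW) (W \<inter> K)) u"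
    and inK: "\<And>t. 0 \<le> t \<Longrightarrow> u t \<in> K"
    and cont: "continuous_on {0..} u"
    using sol unfolding strong_solution_def pos by (auto simp: atLeast_def)
  from sol obtain u' where H: "H1_loc_with_derivative {0<..} u u'"
    and vi: "\<And>v. v \<in> K \<Longrightarrow> AE t in lebesgue. 0 < t \<longrightarrow> 0 \<le> (u' t + G (u t)) \<bullet> (v - u t)"
    unfolding strong_solution_def pos by auto
  have cont0: "continuous_on {0<..} u" by (rule continuous_on_subset[OF cont]) auto
  show ?thesis
  proof unfold_locales
    have img: "u \<in> {0<..} \<rightarrow> W \<inter> K" and cm': "continuous_map (top_of_set {0<..}) (W_topology W nW) u"
      using cm unfolding continuous_map_in_subtopology by auto
    show "continuous_map (top_of_set {0<..}) (W_topology W nW) u" by (rule cm')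
    show "u t \<in> W" "u t \<in> K" if "0 < t" for t using img that by auto
    fix v s t g g'
    assume v: "v \<in> K" and s: "0 < (s::real)" and st: "s \<le> t"
      and g: "\<And>r. r \<in> {s..t} \<Longrightarrow> (g has_real_derivative g' r) (at r within {s..t})"
      and le: "\<And>r. r \<in> {s..t} \<Longrightarrow> G (u r) \<bullet> (v - u r) \<le> g' r"
    from vi[OF v] obtain Z where Z: "negligible Z"
      and Zle: "\<And>r. r \<notin> Z \<Longrightarrow> 0 < r \<Longrightarrow> 0 \<le> (u' r + G (u r)) \<bullet> (v - u r)"
      unfolding eventually_ae_filter_negligible by auto
    show "(norm (u t - v))\<^sup>2 / 2 - (norm (u s - v))\<^sup>2 / 2 \<le> g t - g s"
    proof (rule half_square_distance_increment_le[OF st _ _ _ g Z])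
      show "continuous_on {s..t} u" by (rule continuous_on_subset[OF cont]) (use s in auto)
      show "((\<lambda>r. u' r \<bullet> w) has_integral (u b - u a) \<bullet> w) {a..b}" if "s \<le> a" "a \<le> b" "b \<le> t" for w a b
        using H1_loc_inner_has_integral(1)[OF cont0 H] that s by auto
      show "(\<lambda>r. norm (u' r)) integrable_on {s..t}"
        using H1_loc_inner_has_integral(2)[OF cont0 H] s by auto
      show "u' r \<bullet> (u r - v) \<le> g' r" if "r \<in> {s..t} - Z" for r
        using Zle[of r] le[of r] that s by (auto simp: inner_add_left inner_diff_right)
    qed
  qed
qed

section \<open>Local energy dissipation\<close>

lemma second_difference_quotient_tendsto:
  fixes \<Psi> \<Phi> :: "real \<Rightarrow> real"
  assumes d: "d > 0" and \<Psi>: "\<And>x. \<bar>x - b\<bar> < d \<Longrightarrow> (\<Psi> has_real_derivative \<Phi> x) (at x)"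
    and \<Phi>: "(\<Phi> has_real_derivative D) (at b)"
  shows "((\<lambda>h. (\<Psi> (b + h) - \<Psi> b - h * \<Phi> b) / h\<^sup>2) \<longlongrightarrow> D / 2) (at_right 0)"
proof (rule lhopital_right_0)
  have small: "\<forall>\<^sub>F h in at_right 0. 0 < h \<and> h < d"
    using d by (auto simp: eventually_at_right_less eventually_conj_iff intro: eventually_at_rightI[of 0 d])
  have sh: "((\<lambda>h. b + h) has_real_derivative 1) (at h)" for h
    by (auto intro!: derivative_eq_intros)
  have deriv: "((\<lambda>h. \<Psi> (b + h) - \<Psi> b - h * \<Phi> b) has_real_derivative \<Phi> (b + h) - \<Phi> b) (at h)"
    if "\<bar>h\<bar> < d" for h
    using DERIV_chain2[OF \<Psi> sh, of h] that by (auto intro!: derivative_eq_intros)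
  show "\<forall>\<^sub>F h in at_right 0. ((\<lambda>h. \<Psi> (b + h) - \<Psi> b - h * \<Phi> b) has_real_derivative \<Phi> (b + h) - \<Phi> b) (at h)"
    using small by eventually_elim (auto intro!: deriv)
  have "isCont (\<lambda>h. \<Psi> (b + h) - \<Psi> b - h * \<Phi> b) 0"
    using deriv[of 0] d DERIV_isCont by simp
  then show "((\<lambda>h. \<Psi> (b + h) - \<Psi> b - h * \<Phi> b) \<longlongrightarrow> 0) (at_right 0)"
    unfolding isCont_def by (auto intro: tendsto_within_subset)
  show "((\<lambda>h::real. h\<^sup>2) \<longlongrightarrow> 0) (at_right 0)" by (auto intro!: tendsto_eq_intros)
  show "\<forall>\<^sub>F h in at_right 0. (h::real)\<^sup>2 \<noteq> 0" "\<forall>\<^sub>F h in at_right 0. 2 * (h::real) \<noteq> 0"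
    using small by (eventually_elim; simp)+
  show "\<forall>\<^sub>F h in at_right 0. ((\<lambda>h::real. h\<^sup>2) has_real_derivative 2 * h) (at h)"
    by (auto intro!: always_eventually derivative_eq_intros)
  have "((\<lambda>h. (\<Phi> (b + h) - \<Phi> b) / h) \<longlongrightarrow> D) (at_right 0)"
    using \<Phi> unfolding DERIV_def by (auto intro: tendsto_within_subset)
  then have "((\<lambda>h. (\<Phi> (b + h) - \<Phi> b) / h / 2) \<longlongrightarrow> D / 2) (at_right 0)"
    by (intro tendsto_divide tendsto_const) auto
  then show "((\<lambda>h. (\<Phi> (b + h) - \<Phi> b) / (2 * h)) \<longlongrightarrow> D / 2) (at_right 0)"
    by (simp add: mult.commute)
qed

lemma isCont_imp_tendsto_nhds: "isCont f x \<Longrightarrow> (f \<longlongrightarrow> f x) (nhds x)"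
  by (simp add: isCont_def tendsto_at_iff_tendsto_nhds)

context evi_trajectory
begin

lemma nW_neighbourhood:
  assumes "0 < r0" "0 < \<rho>"
  shows "\<exists>d>0. d \<le> r0 \<and> (\<forall>x. \<bar>x - r0\<bar> < d \<longrightarrow> nW (u r0 - u x) < \<rho>)"
proof -
  interpret M: Metric_space W "W_dist W nW"
    by (rule Metric_space_W_dist[OF subspace_W norm_W])
  define V where "V = {t \<in> {0<..}. u t \<in> M.mball (u r0) \<rho>}"
  have "openin (top_of_set {0<..}) V"
    using openin_continuous_map_preimage[OF continuous_in_W, of "M.mball (u r0) \<rho>"]
    by (simp add: W_topology_def V_def)
  then have "open V" by (simp add: openin_open_eq)
  moreover have "r0 \<in> V" using assms in_W[of r0] by (simp add: V_def)
  ultimately obtain d where d: "d > 0" "ball r0 d \<subseteq> V" using open_contains_ball by blast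
  have "nW (u r0 - u x) < \<rho>" if "\<bar>x - r0\<bar> < min d r0" for x
  proof -
    have "x \<in> ball r0 d" using that by (auto simp: dist_real_def)
    then have "u x \<in> M.mball (u r0) \<rho>" using d(2) by (auto simp: V_def)
    then show ?thesis by (auto simp: W_dist_def split: if_splits)
  qed
  then show ?thesis using d(1) assms(1) by (intro exI[of _ "min d r0"]) auto
qed

lemma continuous_u: "continuous_on {0<..} u"
proof -
  obtain c where c: "\<And>w. w \<in> W \<Longrightarrow> norm w \<le> c * nW w" using continuous_inclusion by blast
  have nonneg: "0 \<le> nW w" if "w \<in> W" for w using norm_W that unfolding norm_on_def by blast
  show ?thesis
    unfolding continuous_on_iff
  proof (intro ballI allI impI)
    fix r0 e :: real assume r0: "r0 \<in> {0<..}" and e: "0 < e"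
    obtain d where d: "d > 0" "d \<le> r0" "\<And>x. \<bar>x - r0\<bar> < d \<Longrightarrow> nW (u r0 - u x) < e / (\<bar>c\<bar> + 1)"
      using nW_neighbourhood[of r0 "e / (\<bar>c\<bar> + 1)"] r0 e by (auto simp: add_nonneg_pos)
    show "\<exists>d>0. \<forall>x'\<in>{0<..}. dist x' r0 < d \<longrightarrow> dist (u x') (u r0) < e"
    proof (intro exI[of _ d] conjI d(1) ballI impI)
      fix x assume x: "x \<in> {0<..}" "dist x r0 < d"
      have w: "u r0 - u x \<in> W" using x r0 by (intro subspace_diff[OF subspace_W] in_W) auto
      have "norm (u r0 - u x) \<le> c * nW (u r0 - u x)" by (rule c[OF w])
      also have "\<dots> \<le> (\<bar>c\<bar> + 1) * nW (u r0 - u x)"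
        by (rule mult_right_mono[OF _ nonneg[OF w]]) simp
      also have "\<dots> < e" using d(3)[of x] x(2) e by (simp add: dist_real_def field_simps)
      finally show "dist (u x) (u r0) < e" by (simp add: dist_norm norm_minus_commute)
    qed
  qed
qed

lemma continuous_F_u: "continuous_on {0<..} (\<lambda>t. F (u t))"
  and continuous_G_u: "continuous_on {0<..} (\<lambda>t. G (u t))"
  using continuous_map_compose[OF continuous_in_W continuous_F] continuous_map_compose[OF continuous_in_W continuous_G]
  by (simp_all add: o_def)

lemma isCont_u: "0 < t \<Longrightarrow> isCont u t"
  and isCont_F_u: "0 < t \<Longrightarrow> isCont (\<lambda>t. F (u t)) t"
  and isCont_G_u: "0 < t \<Longrightarrow> isCont (\<lambda>t. G (u t)) t"
  using continuous_u continuous_F_u continuous_G_u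
  by (simp_all add: continuous_on_eq_continuous_at)

text \<open>The segment between two points of the trajectory close to \<open>u r0\<close> in \<open>W\<close> stays close to \<open>u r0\<close>
  in \<open>W\<close>, by convexity of balls; this is what allows \<open>G\<close> to be controlled on it.\<close>
lemma G_near_on_segments:
  assumes "0 < r0" "0 < e"
  shows "\<exists>d>0. d \<le> r0 \<and> (\<forall>x y \<theta>. \<bar>x - r0\<bar> < d \<longrightarrow> \<bar>y - r0\<bar> < d \<longrightarrow> 0 \<le> \<theta> \<longrightarrow> \<theta> \<le> 1 \<longrightarrow>
           norm (G (u y + \<theta> *\<^sub>R (u x - u y)) - G (u r0)) < e)"
proof -
  interpret M: Metric_space W "W_dist W nW"
    by (rule Metric_space_W_dist[OF subspace_W norm_W])
  define U where "U = {w \<in> W. G w \<in> ball (G (u r0)) e}"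
  have "openin (W_topology W nW) U"
    using openin_continuous_map_preimage[OF continuous_G, of "ball (G (u r0)) e"]
    by (simp add: U_def topspace_W_topology[OF subspace_W norm_W])
  moreover have "u r0 \<in> U" using assms in_W by (simp add: U_def)
  ultimately obtain \<rho> where \<rho>: "\<rho> > 0" "M.mball (u r0) \<rho> \<subseteq> U"
    unfolding W_topology_def M.openin_mtopology by blast
  obtain d where d: "d > 0" "d \<le> r0" "\<And>x. \<bar>x - r0\<bar> < d \<Longrightarrow> nW (u r0 - u x) < \<rho>"
    using nW_neighbourhood[OF assms(1) \<rho>(1)] by blast
  have scale: "nW (c *\<^sub>R w) = \<bar>c\<bar> * nW w" if "w \<in> W" for c w
    using norm_W that unfolding norm_on_def by blast
  have tri: "nW (v + w) \<le> nW v + nW w" if "v \<in> W" "w \<in> W" for v w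
    using norm_W that unfolding norm_on_def by blast
  have "norm (G (u y + \<theta> *\<^sub>R (u x - u y)) - G (u r0)) < e"
    if x: "\<bar>x - r0\<bar> < d" and y: "\<bar>y - r0\<bar> < d" and \<theta>: "0 \<le> \<theta>" "\<theta> \<le> 1" for x y \<theta>
  proof -
    let ?w = "u y + \<theta> *\<^sub>R (u x - u y)"
    have W: "u x \<in> W" "u y \<in> W" "u r0 \<in> W" using x y d assms by (auto intro!: in_W)
    have wW: "?w \<in> W" "u r0 - u x \<in> W" "u r0 - u y \<in> W"
      using W subspace_W by (auto intro!: subspace_add subspace_diff subspace_scale)
    have "u r0 - ?w = (1 - \<theta>) *\<^sub>R (u r0 - u y) + \<theta> *\<^sub>R (u r0 - u x)"
      by (simp add: algebra_simps)
    then have "nW (u r0 - ?w) \<le> (1 - \<theta>) * nW (u r0 - u y) + \<theta> * nW (u r0 - u x)"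
      using tri[of "(1 - \<theta>) *\<^sub>R (u r0 - u y)" "\<theta> *\<^sub>R (u r0 - u x)"] scale wW(2,3) \<theta>
        subspace_scale[OF subspace_W] by simp
    also have "\<dots> < \<rho>"
      by (rule convex_bound_lt[of _ \<rho> _ "1 - \<theta>" \<theta>]) (use d(3) x y \<theta> in auto)
    finally have "?w \<in> M.mball (u r0) \<rho>" using W wW by (simp add: W_dist_def)
    then have "G ?w \<in> ball (G (u r0)) e" using \<rho>(2) by (auto simp: U_def)
    then show ?thesis by (simp add: dist_norm norm_minus_commute)
  qed
  then show ?thesis using d(1,2) by blast
qed

text \<open>The error in the Gateaux expansion of \<open>F\<close> is uniform near each point of the trajectory: by the
  mean value theorem it is governed by the variation of \<open>G\<close> on the segment.\<close>
lemma F_expansion: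
  assumes "0 < r0" "0 < e"
  shows "\<exists>d>0. d \<le> r0 \<and> (\<forall>x y. \<bar>x - r0\<bar> < d \<longrightarrow> \<bar>y - r0\<bar> < d \<longrightarrow>
           \<bar>F (u x) - F (u y) - G (u y) \<bullet> (u x - u y)\<bar> \<le> e * norm (u x - u y))"
proof -
  obtain d where d: "d > 0" "d \<le> r0"
    "\<And>x y \<theta>. \<bar>x - r0\<bar> < d \<Longrightarrow> \<bar>y - r0\<bar> < d \<Longrightarrow> 0 \<le> \<theta> \<Longrightarrow> \<theta> \<le> 1 \<Longrightarrow>
      norm (G (u y + \<theta> *\<^sub>R (u x - u y)) - G (u r0)) < e / 2"
    using G_near_on_segments[OF assms(1), of "e/2"] assms(2) by auto
  have "\<bar>F (u x) - F (u y) - G (u y) \<bullet> (u x - u y)\<bar> \<le> e * norm (u x - u y)"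
    if x: "\<bar>x - r0\<bar> < d" and y: "\<bar>y - r0\<bar> < d" for x y
  proof -
    define \<Delta> where "\<Delta> = u x - u y"
    have W: "u y \<in> W" "\<Delta> \<in> W"
      unfolding \<Delta>_def using x y d by (auto intro!: in_W subspace_diff[OF subspace_W])
    have deriv: "((\<lambda>\<theta>. F (u y + \<theta> *\<^sub>R \<Delta>)) has_real_derivative \<Delta> \<bullet> G (u y + \<theta> *\<^sub>R \<Delta>)) (at \<theta>)" for \<theta>
    proof -
      have "((\<lambda>t. F ((u y + \<theta> *\<^sub>R \<Delta>) + t *\<^sub>R \<Delta>)) has_real_derivative \<Delta> \<bullet> G (u y + \<theta> *\<^sub>R \<Delta>)) (at 0)"
        using W by (intro gradient) (auto intro!: subspace_add[OF subspace_W] subspace_scale[OF subspace_W])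
      then have "((\<lambda>t. F (u y + (t + \<theta>) *\<^sub>R \<Delta>)) has_real_derivative \<Delta> \<bullet> G (u y + \<theta> *\<^sub>R \<Delta>)) (at 0)"
        by (simp add: scaleR_add_left add.commute add.left_commute)
      then show ?thesis using DERIV_shift[of "\<lambda>\<theta>. F (u y + \<theta> *\<^sub>R \<Delta>)" _ 0 \<theta>] by simp
    qed
    obtain \<theta> where \<theta>: "0 < \<theta>" "\<theta> < 1" "F (u y + 1 *\<^sub>R \<Delta>) - F (u y + 0 *\<^sub>R \<Delta>) = (1 - 0) * (\<Delta> \<bullet> G (u y + \<theta> *\<^sub>R \<Delta>))"
      using MVT2[of 0 1 "\<lambda>\<theta>. F (u y + \<theta> *\<^sub>R \<Delta>)", OF _ deriv] by auto
    then have "F (u x) - F (u y) - G (u y) \<bullet> \<Delta> = \<Delta> \<bullet> (G (u y + \<theta> *\<^sub>R \<Delta>) - G (u y))"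
      by (simp add: \<Delta>_def inner_diff inner_commute)
    also have "\<bar>\<dots>\<bar> \<le> norm \<Delta> * norm (G (u y + \<theta> *\<^sub>R \<Delta>) - G (u y))"
      by (rule Cauchy_Schwarz_ineq2)
    also have "norm (G (u y + \<theta> *\<^sub>R \<Delta>) - G (u y)) \<le> e"
      using d(3)[OF x y, of \<theta>] d(3)[OF x y, of 0] \<theta> norm_triangle_ineq4[of "G (u y + \<theta> *\<^sub>R \<Delta>) - G (u r0)" "G (u y) - G (u r0)"]
      by (simp add: \<Delta>_def)
    finally show ?thesis by (simp add: \<Delta>_def mult.commute[of e] mult_left_mono)
  qed
  then show ?thesis using d(1,2) by blast
qed

text \<open>Put \<open>v = u s\<close> in the variational inequality and let \<open>m\<close> be the largest distance from \<open>u s\<close> reached on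
  \<open>[s,t]\<close>: half of \<open>m\<^sup>2\<close> is at most \<open>M * m * (t - s)\<close>, where \<open>M\<close> bounds \<open>G\<close> along the trajectory.\<close>
lemma locally_Lipschitz:
  assumes r0: "0 < r0"
  shows "\<exists>L>0. \<exists>d>0. d \<le> r0 \<and> (\<forall>x y. \<bar>x - r0\<bar> < d \<longrightarrow> \<bar>y - r0\<bar> < d \<longrightarrow> norm (u x - u y) \<le> L * \<bar>x - y\<bar>)"
proof -
  define M where "M = norm (G (u r0)) + 1"
  have M: "M > 0" unfolding M_def by (simp add: add_nonneg_pos)
  have "isCont (\<lambda>t. norm (G (u t))) r0" by (intro continuous_intros isCont_G_u r0)
  then have "\<forall>\<^sub>F t in nhds r0. norm (G (u t)) < M"
    by (intro order_tendstoD(2)[OF isCont_imp_tendsto_nhds]) (auto simp: M_def)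
  then obtain d where d: "d > 0" "\<And>t. \<bar>t - r0\<bar> < d \<Longrightarrow> norm (G (u t)) < M"
    unfolding eventually_nhds_metric dist_real_def by blast
  have Lip: "norm (u t - u s) \<le> 2 * M * (t - s)"
    if s: "\<bar>s - r0\<bar> < min d r0" and t: "\<bar>t - r0\<bar> < min d r0" and st: "s \<le> t" for s t
  proof -
    have s0: "0 < s" using s by (simp add: abs_less_iff)
    have "continuous_on {s..t} (\<lambda>r. norm (u r - u s))"
      by (intro continuous_intros continuous_on_subset[OF continuous_u]) (use s0 in auto)
    then obtain q where q: "q \<in> {s..t}" and max: "\<And>r. r \<in> {s..t} \<Longrightarrow> norm (u r - u s) \<le> norm (u q - u s)"
      using continuous_attains_sup[of "{s..t}" "\<lambda>r. norm (u r - u s)"] st by auto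
    define m where "m = norm (u q - u s)"
    have "(norm (u q - u s))\<^sup>2 / 2 - (norm (u s - u s))\<^sup>2 / 2 \<le> M * m * q - M * m * s"
    proof (rule evi[where g="\<lambda>r. M * m * r" and g'="\<lambda>r. M * m"])
      show "G (u r) \<bullet> (u s - u r) \<le> M * m" if r: "r \<in> {s..q}" for r
      proof -
        have "norm (G (u r)) \<le> M" using r q s t by (intro less_imp_le d(2)) auto
        moreover have "norm (u s - u r) \<le> m" using max[of r] r q by (simp add: m_def norm_minus_commute)
        ultimately show ?thesis
          using norm_cauchy_schwarz[of "G (u r)" "u s - u r"] mult_mono[of "norm (G (u r))" M "norm (u s - u r)" m] M
          by simp
      qed
    qed (use s0 q in \<open>auto intro!: in_K derivative_eq_intros\<close>)
    then have "m * m \<le> m * (2 * M * (q - s))" by (simp add: m_def power2_eq_square algebra_simps)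
    moreover have "0 \<le> 2 * M * (q - s)" using M q by simp
    ultimately have "m \<le> 2 * M * (q - s)"
      by (metis m_def mult_le_cancel_left_pos norm_ge_zero order_le_less)
    also have "\<dots> \<le> 2 * M * (t - s)" using M q by simp
    finally show ?thesis using max[of t] st by (simp add: m_def)
  qed
  have "norm (u x - u y) \<le> 2 * M * \<bar>x - y\<bar>"
    if "\<bar>x - r0\<bar> < min d r0" "\<bar>y - r0\<bar> < min d r0" for x y
    using Lip[of x y] Lip[of y x] that by (cases "x \<le> y") (auto simp: norm_minus_commute)
  then show ?thesis using d(1) M r0
    by (intro exI[of _ "2 * M"] conjI exI[of _ "min d r0"]) auto
qed

text \<open>The trajectory moves at least as fast as the constrained slope: a point \<open>v\<close> of \<open>K\<close> that nearly
  realises the slope is approached at a rate of at least \<open>\<kappa>\<close>, and the distance to \<open>v\<close> decreases by at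
  most the displacement.\<close>
lemma speed_ge_slope:
  assumes r0: "0 < r0" and \<kappa>: "0 \<le> \<kappa>" "\<kappa> < constrained_grad_norm K G (u r0)"
  shows "\<exists>d>0. d \<le> r0 \<and> (\<forall>s t. \<bar>s - r0\<bar> < d \<longrightarrow> \<bar>t - r0\<bar> < d \<longrightarrow> s \<le> t \<longrightarrow> \<kappa> * (t - s) \<le> norm (u t - u s))"
proof -
  obtain z where "z \<in> insert 0 ((\<lambda>v. - ((v - u r0) \<bullet> G (u r0)) / norm (v - u r0)) ` (K - {u r0}))" "\<kappa> < z"
    using \<kappa>(2) unfolding constrained_grad_norm_def by (rule less_cSupE) auto
  then obtain v where v: "v \<in> K" "v \<noteq> u r0" "\<kappa> < - ((v - u r0) \<bullet> G (u r0)) / norm (v - u r0)"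
    using \<kappa>(1) by auto
  define P where "P t = G (u t) \<bullet> (u t - v)" for t
  have "\<kappa> * norm (u r0 - v) < P r0"
    using v(2,3) by (simp add: P_def pos_less_divide_eq norm_minus_commute inner_diff inner_commute)
  then obtain \<mu> where \<mu>: "\<kappa> * norm (u r0 - v) < \<mu>" "\<mu> < P r0" using dense by blast
  have \<mu>0: "0 < \<mu>" using \<mu>(1) \<kappa>(1) by (smt (verit) mult_nonneg_nonneg norm_ge_zero)
  have "isCont P r0" "isCont (\<lambda>t. \<kappa> * norm (u t - v)) r0"
    unfolding P_def by (intro continuous_intros isCont_G_u isCont_u r0)+
  then have "\<forall>\<^sub>F t in nhds r0. \<mu> < P t" "\<forall>\<^sub>F t in nhds r0. \<kappa> * norm (u t - v) < \<mu>"
    using \<mu> by (auto dest!: isCont_imp_tendsto_nhds dest: order_tendstoD)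
  then have "\<forall>\<^sub>F t in nhds r0. \<mu> < P t \<and> \<kappa> * norm (u t - v) < \<mu>" by (rule eventually_conj)
  then obtain d where d: "d > 0" "\<And>t. \<bar>t - r0\<bar> < d \<Longrightarrow> \<mu> < P t \<and> \<kappa> * norm (u t - v) < \<mu>"
    unfolding eventually_nhds_metric dist_real_def by blast
  have "\<kappa> * (t - s) \<le> norm (u t - u s)"
    if s: "\<bar>s - r0\<bar> < min d r0" and t: "\<bar>t - r0\<bar> < min d r0" and st: "s \<le> t" for s t
  proof (cases "s = t")
    case False
    define A B where "A = norm (u s - v)" and "B = norm (u t - v)"
    have "B\<^sup>2 / 2 - A\<^sup>2 / 2 \<le> - \<mu> * t - (- \<mu> * s)"
      unfolding A_def B_def
    proof (rule evi[where g="\<lambda>r. - \<mu> * r" and g'="\<lambda>r. - \<mu>"])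
      show "G (u r) \<bullet> (v - u r) \<le> - \<mu>" if "r \<in> {s..t}" for r
      proof -
        have "\<bar>r - r0\<bar> < d" using that s t by (auto simp: abs_less_iff)
        then show ?thesis using d(2)[of r] by (simp add: P_def inner_diff)
      qed
    qed (use s st v in \<open>auto intro!: derivative_eq_intros\<close>)
    then have 1: "2 * \<mu> * (t - s) \<le> (A - B) * (A + B)" by (simp add: power2_eq_square algebra_simps)
    have pos: "0 < 2 * \<mu> * (t - s)" using \<mu>0 st False by simp
    have AB: "0 \<le> A" "0 \<le> B" by (simp_all add: A_def B_def)
    then have "B < A" using 1 pos by (smt (verit) mult_nonpos_nonneg)
    have diff: "A - B \<le> norm (u t - u s)"
      using norm_triangle_ineq2[of "u s - v" "u t - v"] by (simp add: A_def B_def norm_minus_commute)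
    have "2 * (\<kappa> * A) * (t - s) \<le> 2 * \<mu> * (t - s)"
      using d(2)[of s] s st by (intro mult_right_mono) (auto simp: A_def)
    also note 1
    also have "(A - B) * (A + B) \<le> norm (u t - u s) * (2 * A)"
      by (rule mult_mono[OF diff]) (use AB \<open>B < A\<close> in auto)
    finally have "A * (\<kappa> * (t - s)) \<le> A * norm (u t - u s)" by (simp add: algebra_simps)
    then show ?thesis using AB \<open>B < A\<close> by (simp add: mult_le_cancel_left)
  qed simp
  then show ?thesis using d(1) r0 by (intro exI[of _ "min d r0"]) auto
qed

text \<open>Formally the energy decreases at the rate \<open>(norm u')\<^sup>2 \<ge> slope * norm u'\<close>. Difference quotients with
  step \<open>h\<close> replace the derivative of \<open>u\<close>. Putting \<open>v = u r\<close> in the variational inequality on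
  \<open>[r, r + h]\<close> and expanding \<open>F\<close> gives
  \<open>(norm (u (r + h) - u r))\<^sup>2 / 2 \<le> h * f r - (\<Phi> (r + h) - \<Phi> r) + \<epsilon> * h\<^sup>2 / 2\<close>
  with \<open>\<Phi>\<close> an antiderivative of \<open>f = F \<circ> u\<close>. Integrated over \<open>r\<close> from \<open>a\<close> to \<open>b\<close>, the right-hand side is
  a second difference of an antiderivative \<open>\<Psi>\<close> of \<open>\<Phi>\<close>, and after division by \<open>h\<^sup>2\<close> it tends to half of
  \<open>f a - f b\<close>. The averages of the increments of \<open>u\<close> on the left tend to \<open>u b - u a\<close>.
  The gap between \<open>\<kappa>\<close> and the slope pays for \<open>\<epsilon>\<close>.\<close>
lemma energy_drop_ge_slope_times_displacement:
  assumes r0: "0 < r0" and \<kappa>: "0 \<le> \<kappa>" "\<kappa> < constrained_grad_norm K G (u r0)"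
  shows "\<exists>d>0. d \<le> r0 \<and> (\<forall>a b. \<bar>a - r0\<bar> < d \<longrightarrow> \<bar>b - r0\<bar> < d \<longrightarrow> a \<le> b \<longrightarrow>
           \<kappa> * norm (u b - u a) \<le> F (u a) - F (u b) \<and> \<kappa> * (b - a) \<le> norm (u b - u a))"
proof -
  obtain \<kappa>1 where \<kappa>1: "\<kappa> < \<kappa>1" "\<kappa>1 < constrained_grad_norm K G (u r0)" using \<kappa>(2) dense by blast
  \<comment> \<open>The largest error for which \<open>q \<ge> \<kappa>1 * h\<close> still implies \<open>\<kappa> * h * q \<le> q\<^sup>2 - \<epsilon> * h\<^sup>2\<close>.\<close>
  define \<epsilon> where "\<epsilon> = (\<kappa>1 - \<kappa>) * \<kappa>1"
  have \<epsilon>: "\<epsilon> > 0" using \<kappa> \<kappa>1 by (simp add: \<epsilon>_def)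
  obtain L d1 where L: "L > 0" "d1 > 0" "d1 \<le> r0"
    "\<And>x y. \<bar>x - r0\<bar> < d1 \<Longrightarrow> \<bar>y - r0\<bar> < d1 \<Longrightarrow> norm (u x - u y) \<le> L * \<bar>x - y\<bar>"
    using locally_Lipschitz[OF r0] by blast
  have "0 < \<epsilon> / L" using L \<epsilon> by simp
  from F_expansion[OF r0 this] obtain d2 where d2: "d2 > 0"
    "\<And>x y. \<bar>x - r0\<bar> < d2 \<Longrightarrow> \<bar>y - r0\<bar> < d2 \<Longrightarrow>
           \<bar>F (u x) - F (u y) - G (u y) \<bullet> (u x - u y)\<bar> \<le> \<epsilon> / L * norm (u x - u y)" by blast
  have "0 \<le> \<kappa>1" using \<kappa> \<kappa>1 by simp
  from speed_ge_slope[OF r0 this \<kappa>1(2)] obtain d3 where d3: "d3 > 0"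
    "\<And>s t. \<bar>s - r0\<bar> < d3 \<Longrightarrow> \<bar>t - r0\<bar> < d3 \<Longrightarrow> s \<le> t \<Longrightarrow> \<kappa>1 * (t - s) \<le> norm (u t - u s)" by blast
  define d where "d = min d1 (min d2 d3)"
  have d: "d > 0" "d \<le> d1" "d \<le> d2" "d \<le> d3" using L d2 d3 by (auto simp: d_def)
  have "\<kappa> * norm (u b - u a) \<le> F (u a) - F (u b)"
    if a: "\<bar>a - r0\<bar> < d" and b: "\<bar>b - r0\<bar> < d" and ab: "a < b" for a b
  proof -
    \<comment> \<open>A margin on both sides of \<open>[a,b]\<close>, so that antiderivatives on \<open>[c,e]\<close> are
      differentiable at \<open>a\<close>, \<open>b\<close> and slightly to the right of \<open>b\<close>.\<close>
    define c e where "c = (a + (r0 - d)) / 2" and "e = (b + (r0 + d)) / 2"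
    have ce: "r0 - d < c" "c < a" "b < e" "e < r0 + d" using a b by (auto simp: c_def e_def abs_less_iff)
    have near: "\<bar>x - r0\<bar> < d" if "x \<in> {c..e}" for x using that ce by (auto simp: abs_less_iff)
    have pos: "0 < x" if "x \<in> {c..e}" for x using near[OF that] d L by (auto simp: abs_less_iff)
    define f where "f r = F (u r)" for r
    \<comment> \<open>Only the component along the displacement matters, so real antiderivatives suffice;
      a direction of norm at most one is enough, which also covers \<open>u a = u b\<close>.\<close>
    define w where "w = sgn (u b - u a)"
    have w: "norm w \<le> 1" "(u b - u a) \<bullet> w = norm (u b - u a)"
      by (cases "u b = u a"; simp add: w_def sgn_div_norm dot_square_norm power2_eq_square)+
    define y where "y r = u r \<bullet> w" for r
    have cf: "continuous_on {c..e} f"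
      unfolding f_def by (rule continuous_on_subset[OF continuous_F_u]) (use pos in auto)
    have cy: "continuous_on {c..e} y"
      unfolding y_def by (intro continuous_intros continuous_on_subset[OF continuous_u]) (use pos in auto)
    from antiderivative_continuous[OF cf] antiderivative_continuous[OF cy]
    obtain \<Phi> U where \<Phi>: "\<And>x. x \<in> {c..e} \<Longrightarrow> (\<Phi> has_real_derivative f x) (at x within {c..e})"
      and U: "\<And>x. x \<in> {c..e} \<Longrightarrow> (U has_real_derivative y x) (at x within {c..e})"
      by (metis has_real_derivative_iff_has_vector_derivative)
    have "continuous_on {c..e} \<Phi>" by (rule DERIV_continuous_on[OF \<Phi>])
    from antiderivative_continuous[OF this]
    obtain \<Psi> where \<Psi>: "\<And>x. x \<in> {c..e} \<Longrightarrow> (\<Psi> has_real_derivative \<Phi> x) (at x within {c..e})"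
      by (metis has_real_derivative_iff_has_vector_derivative)
    have at: "(\<Phi> has_real_derivative f x) (at x)" "(\<Psi> has_real_derivative \<Phi> x) (at x)"
      "(U has_real_derivative y x) (at x)" if "c < x" "x < e" for x
      using \<Phi>[of x] \<Psi>[of x] U[of x] that at_within_Icc_at[of c x e] by auto
    define X where "X h r = \<kappa> * h * (U (r + h) - U r)" for h r
    define Y where "Y h r = 2 * (h * \<Phi> r - \<Psi> (r + h) + \<Psi> r)" for h r
    have XY: "Y h a - X h a \<le> Y h b - X h b" if h: "0 < h" "h < e - b" for h
    proof (rule DERIV_nonneg_imp_nondecreasing[where f="\<lambda>r. Y h r - X h r"])
      show "a \<le> b" using ab by simp
      have sh: "((\<lambda>r. r + h) has_real_derivative 1) (at r)" for r
        by (auto intro!: derivative_eq_intros)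
      have X': "(X h has_real_derivative \<kappa> * h * (y (r + h) - y r)) (at r)" if "a \<le> r" "r \<le> b" for r
      proof -
        have "((\<lambda>r. U (r + h)) has_real_derivative y (r + h) * 1) (at r)"
          by (rule DERIV_chain2[OF at(3) sh]) (use that ce h in auto)
        moreover have "(U has_real_derivative y r) (at r)" by (rule at; use that ce in auto)
        ultimately show ?thesis unfolding X_def[abs_def] by (auto intro!: derivative_eq_intros)
      qed
      have Y': "(Y h has_real_derivative 2 * (h * f r - \<Phi> (r + h) + \<Phi> r)) (at r)" if "a \<le> r" "r \<le> b" for r
      proof -
        have "((\<lambda>r. \<Psi> (r + h)) has_real_derivative \<Phi> (r + h) * 1) (at r)"
          by (rule DERIV_chain2[OF at(2) sh]) (use that ce h in auto)
        moreover have "(\<Phi> has_real_derivative f r) (at r)" "(\<Psi> has_real_derivative \<Phi> r) (at r)"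
          by (rule at; use that ce in auto)+
        ultimately show ?thesis unfolding Y_def[abs_def] by (auto intro!: derivative_eq_intros)
      qed
      fix r assume r: "a \<le> r" "r \<le> b"
      define q where "q = norm (u (r + h) - u r)"
      have "(norm (u (r + h) - u r))\<^sup>2 / 2 - (norm (u r - u r))\<^sup>2 / 2
          \<le> ((r + h) * f r - \<Phi> (r + h) + \<epsilon> / 2 * (r + h - r)\<^sup>2) - (r * f r - \<Phi> r + \<epsilon> / 2 * (r - r)\<^sup>2)"
      proof (rule evi[where g="\<lambda>\<sigma>. \<sigma> * f r - \<Phi> \<sigma> + \<epsilon> / 2 * (\<sigma> - r)\<^sup>2" and g'="\<lambda>\<sigma>. f r - f \<sigma> + \<epsilon> * (\<sigma> - r)"])
        show "u r \<in> K" "0 < r" using pos[of r] ce r by (auto intro!: in_K)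
        show "r \<le> r + h" using h by simp
        fix \<sigma> assume \<sigma>: "\<sigma> \<in> {r..r + h}"
        have "(\<Phi> has_real_derivative f \<sigma>) (at \<sigma>)" by (rule at) (use \<sigma> r h ce in auto)
        then have "((\<lambda>\<sigma>. \<sigma> * f r - \<Phi> \<sigma> + \<epsilon> / 2 * (\<sigma> - r)\<^sup>2) has_real_derivative f r - f \<sigma> + \<epsilon> * (\<sigma> - r)) (at \<sigma>)"
          by (auto intro!: derivative_eq_intros)
        then show "((\<lambda>\<sigma>. \<sigma> * f r - \<Phi> \<sigma> + \<epsilon> / 2 * (\<sigma> - r)\<^sup>2) has_real_derivative f r - f \<sigma> + \<epsilon> * (\<sigma> - r)) (at \<sigma> within {r..r+h})"
          by (rule has_field_derivative_at_within)
        have n: "\<bar>r - r0\<bar> < d" "\<bar>\<sigma> - r0\<bar> < d" using near \<sigma> r h ce by auto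
        have "G (u \<sigma>) \<bullet> (u r - u \<sigma>) \<le> f r - f \<sigma> + \<epsilon> / L * norm (u r - u \<sigma>)"
          using d2(2)[of r \<sigma>] n d by (auto simp: f_def abs_le_iff)
        also have "\<epsilon> / L * norm (u r - u \<sigma>) \<le> \<epsilon> / L * (L * \<bar>r - \<sigma>\<bar>)"
          by (rule mult_left_mono[OF L(4)]) (use n d \<epsilon> L in auto)
        also have "\<dots> = \<epsilon> * (\<sigma> - r)" using L \<sigma> by simp
        finally show "G (u \<sigma>) \<bullet> (u r - u \<sigma>) \<le> f r - f \<sigma> + \<epsilon> * (\<sigma> - r)" by simp
      qed
      then have sq: "q\<^sup>2 - \<epsilon> * h\<^sup>2 \<le> 2 * (h * f r - \<Phi> (r + h) + \<Phi> r)"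
        by (simp add: q_def algebra_simps)
      have q: "\<kappa>1 * h \<le> q"
        using d3(2)[of r "r + h"] near[of r] near[of "r + h"] r h ce d by (auto simp: q_def)
      have "\<epsilon> * h\<^sup>2 = (\<kappa>1 * h) * (\<kappa>1 * h - \<kappa> * h)" by (simp add: \<epsilon>_def power2_eq_square algebra_simps)
      also have "\<dots> \<le> q * (q - \<kappa> * h)"
        by (rule mult_mono) (use q \<kappa> \<kappa>1 h in \<open>auto simp: q_def\<close>)
      finally have "\<kappa> * h * q \<le> q\<^sup>2 - \<epsilon> * h\<^sup>2" by (simp add: power2_eq_square algebra_simps)
      with sq have "\<kappa> * h * q \<le> 2 * (h * f r - \<Phi> (r + h) + \<Phi> r)" by simp
      moreover have "y (r + h) - y r \<le> q"
        using norm_cauchy_schwarz[of "u (r + h) - u r" w] mult_left_le[OF w(1), of q]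
        by (simp add: y_def q_def inner_diff_left)
      then have "\<kappa> * h * (y (r + h) - y r) \<le> \<kappa> * h * q"
        using \<kappa>(1) h by (intro mult_left_mono) auto
      ultimately have "0 \<le> 2 * (h * f r - \<Phi> (r + h) + \<Phi> r) - \<kappa> * h * (y (r + h) - y r)" by simp
      then show "\<exists>D. ((\<lambda>r. Y h r - X h r) has_real_derivative D) (at r) \<and> 0 \<le> D"
        using DERIV_diff[OF Y' X', of r] r by blast
    qed
    have Ylim: "((\<lambda>h. Y h r / h\<^sup>2) \<longlongrightarrow> - f r) (at_right 0)" if "a \<le> r" "r \<le> b" for r
    proof -
      have "((\<lambda>h. (\<Psi> (r + h) - \<Psi> r - h * \<Phi> r) / h\<^sup>2) \<longlongrightarrow> f r / 2) (at_right 0)"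
        by (rule second_difference_quotient_tendsto[where d="min (r - c) (e - r)"])
          (use that ce in \<open>auto intro!: at simp: abs_less_iff\<close>)
      from tendsto_mult_left[OF this, of "-2"] show ?thesis
        by (simp add: Y_def diff_divide_distrib add_divide_distrib algebra_simps)
    qed
    have Xlim: "((\<lambda>h. X h r / h\<^sup>2) \<longlongrightarrow> \<kappa> * y r) (at_right 0)" if "a \<le> r" "r \<le> b" for r
    proof -
      have "(U has_real_derivative y r) (at r)" by (rule at) (use that ce in auto)
      then have "((\<lambda>h. (U (r + h) - U r) / h) \<longlongrightarrow> y r) (at_right 0)"
        unfolding DERIV_def by (auto intro: tendsto_within_subset)
      then have "((\<lambda>h. \<kappa> * ((U (r + h) - U r) / h)) \<longlongrightarrow> \<kappa> * y r) (at_right 0)"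
        by (intro tendsto_mult tendsto_const)
      moreover have "\<forall>\<^sub>F h in at_right 0. \<kappa> * ((U (r + h) - U r) / h) = X h r / h\<^sup>2"
        by (rule eventually_at_rightI[of 0 1]) (auto simp: X_def power2_eq_square)
      ultimately show ?thesis by (rule Lim_transform_eventually)
    qed
    have "- f a - \<kappa> * y a \<le> - f b - \<kappa> * y b"
    proof (rule tendsto_le)
      show "((\<lambda>h. Y h b / h\<^sup>2 - X h b / h\<^sup>2) \<longlongrightarrow> - f b - \<kappa> * y b) (at_right 0)"
        "((\<lambda>h. Y h a / h\<^sup>2 - X h a / h\<^sup>2) \<longlongrightarrow> - f a - \<kappa> * y a) (at_right 0)"
        using ab by (intro tendsto_diff Ylim Xlim; simp)+
      show "\<forall>\<^sub>F h in at_right 0. Y h a / h\<^sup>2 - X h a / h\<^sup>2 \<le> Y h b / h\<^sup>2 - X h b / h\<^sup>2"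
        by (rule eventually_at_rightI[of 0 "e - b"])
          (use XY ce in \<open>auto simp flip: diff_divide_distrib intro!: divide_right_mono\<close>)
    qed simp
    then have "\<kappa> * ((u b - u a) \<bullet> w) \<le> f a - f b" by (simp add: y_def inner_diff_left right_diff_distrib)
    then show ?thesis by (simp add: w f_def)
  qed
  then have drop: "\<kappa> * norm (u b - u a) \<le> F (u a) - F (u b)"
    if "\<bar>a - r0\<bar> < d" "\<bar>b - r0\<bar> < d" "a \<le> b" for a b
    using that by (cases "a = b") auto
  have "\<kappa> * (b - a) \<le> norm (u b - u a)"
    if ab: "\<bar>a - r0\<bar> < d" "\<bar>b - r0\<bar> < d" "a \<le> b" for a b
  proof -
    have "\<kappa> * (b - a) \<le> \<kappa>1 * (b - a)" using \<kappa>1(1) ab(3) by (intro mult_right_mono) auto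
    also have "\<dots> \<le> norm (u b - u a)" by (rule d3(2)) (use ab d in auto)
    finally show ?thesis .
  qed
  with drop d L show ?thesis by (intro exI[of _ d]) simp
qed

end

section \<open>Consequences of the Lojasiewicz inequality\<close>

text \<open>The mean value theorem, used for a positive exponent \<open>\<gamma>\<close> (length) and a negative exponent
  \<open>-(1 - 2 * \<gamma>)\<close> (decay); both make \<open>x powr (p - 1)\<close> decreasing.\<close>
lemma powr_difference_quotient_ge:
  fixes A B p :: real
  assumes "0 < B" "B \<le> A" "p \<noteq> 0" "p \<le> 1"
  shows "A powr (p - 1) * (A - B) \<le> (A powr p - B powr p) / p"
proof (cases "A = B")
  case False
  then have "B < A" using assms by simp
  moreover have "((\<lambda>x. x powr p) has_real_derivative p * x powr (p - 1)) (at x)" if "B \<le> x" for x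
    using has_real_derivative_powr[of x p] that assms(1) by simp
  ultimately obtain z where z: "B < z" "z < A" "A powr p - B powr p = (A - B) * (p * z powr (p - 1))"
    using MVT2[of B A "\<lambda>x. x powr p" "\<lambda>x. p * x powr (p - 1)"] by blast
  have "A powr (p - 1) \<le> z powr (p - 1)"
    using z assms by (intro powr_mono2') auto
  then have "A powr (p - 1) * (A - B) \<le> z powr (p - 1) * (A - B)"
    using \<open>B < A\<close> by (intro mult_right_mono) auto
  also have "\<dots> = (A powr p - B powr p) / p" using z(3) assms(3) by simp
  finally show ?thesis .
qed simp

lemma converges_of_displacement_bound:
  fixes u :: "real \<Rightarrow> 'a::{real_normed_vector,complete_space}"
  assumes disp: "\<And>s t. s0 \<le> s \<Longrightarrow> s \<le> t \<Longrightarrow> norm (u t - u s) \<le> B s"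
    and B: "(B \<longlongrightarrow> 0) at_top"
  shows "\<exists>l. (u \<longlongrightarrow> l) at_top \<and> (\<forall>s\<ge>s0. norm (u s - l) \<le> B s)"
proof -
  have "Cauchy (\<lambda>n. u (real n))"
  proof (rule metric_CauchyI)
    fix e :: real assume "0 < e"
    then have "\<forall>\<^sub>F s in at_top. B s < e / 2" using B by (intro order_tendstoD(2)[of _ 0]) auto
    then obtain a where a: "\<And>s. a \<le> s \<Longrightarrow> B s < e / 2" unfolding eventually_at_top_linorder by blast
    define s where "s = max a s0"
    have near: "dist (u (real n)) (u s) < e / 2" if "nat \<lceil>s\<rceil> \<le> n" for n
    proof -
      have "s \<le> real n" using that by linarith
      then have "norm (u (real n) - u s) \<le> B s" by (intro disp) (auto simp: s_def)
      also have "B s < e / 2" by (rule a) (simp add: s_def)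
      finally show ?thesis by (simp add: dist_norm)
    qed
    show "\<exists>M. \<forall>m\<ge>M. \<forall>n\<ge>M. dist (u (real m)) (u (real n)) < e"
    proof (intro exI[of _ "nat \<lceil>s\<rceil>"] allI impI)
      fix m n assume "nat \<lceil>s\<rceil> \<le> m" "nat \<lceil>s\<rceil> \<le> n"
      from near[OF this(1)] near[OF this(2)] show "dist (u (real m)) (u (real n)) < e"
        by (rule dist_triangle_half_l)
    qed
  qed
  then obtain l where l: "(\<lambda>n. u (real n)) \<longlonglongrightarrow> l"
    using Cauchy_convergent convergent_def by blast
  have bound: "norm (u s - l) \<le> B s" if s: "s0 \<le> s" for s
  proof (rule tendsto_upperbound)
    show "(\<lambda>n. norm (u s - u (real n))) \<longlonglongrightarrow> norm (u s - l)"
      by (intro tendsto_intros l)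
    show "\<forall>\<^sub>F n in sequentially. norm (u s - u (real n)) \<le> B s"
      using eventually_ge_at_top[of "nat \<lceil>s\<rceil>"]
    proof eventually_elim
      case (elim n)
      then have "s \<le> real n" by linarith
      from disp[OF s this] show ?case by (subst norm_minus_commute)
    qed
  qed simp
  have "((\<lambda>t. u t - l) \<longlongrightarrow> 0) at_top"
    by (rule Lim_null_comparison[OF _ B]) (use bound in \<open>auto intro!: eventually_at_top_linorderI[of s0]\<close>)
  then have "(u \<longlongrightarrow> l) at_top" by (simp add: LIM_zero_iff)
  with bound show ?thesis by blast
qed

context evi_trajectory
begin

text \<open>From here on \<open>c0\<close> is the critical energy level, and \<open>C\<close> and \<open>\<gamma>\<close> are the constant and the exponent
  in the Lojasiewicz inequality, which each lemma assumes at the times where it is used.\<close>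
context
  fixes C \<gamma> c0 :: real
  assumes C: "0 < C" and \<gamma>: "0 < \<gamma>" "\<gamma> \<le> 1/2"
begin

text \<open>By the Lojasiewicz inequality \<open>\<kappa>\<close> is at most half the slope, hence strictly below it, so
  that the local dissipation estimate applies.\<close>
lemma local_energy_drop:
  assumes x: "0 < x" and f: "c0 < F (u x)"
    and Loj: "(F (u x) - c0) powr (1 - \<gamma>) \<le> C * constrained_grad_norm K G (u x)"
  defines "\<kappa> \<equiv> (F (u x) - c0) powr (1 - \<gamma>) / (2 * C)"
  shows "\<exists>d>0. \<forall>a b. \<bar>a - x\<bar> < d \<longrightarrow> \<bar>b - x\<bar> < d \<longrightarrow> a \<le> b \<longrightarrow>
     F (u a) - c0 \<le> 2 * (F (u x) - c0) \<and> F (u b) \<le> F (u a) \<and>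
     \<kappa> * norm (u b - u a) \<le> F (u a) - F (u b) \<and> \<kappa>\<^sup>2 * (b - a) \<le> F (u a) - F (u b)"
proof -
  have \<kappa>0: "0 < \<kappa>" using f C by (simp add: \<kappa>_def)
  have "2 * \<kappa> \<le> constrained_grad_norm K G (u x)"
    using Loj C by (simp add: \<kappa>_def field_simps)
  then have "\<kappa> < constrained_grad_norm K G (u x)" using \<kappa>0 by simp
  from energy_drop_ge_slope_times_displacement[OF x _ this] \<kappa>0
  obtain d1 where d1: "d1 > 0" "\<And>a b. \<bar>a - x\<bar> < d1 \<Longrightarrow> \<bar>b - x\<bar> < d1 \<Longrightarrow> a \<le> b \<Longrightarrow>
      \<kappa> * norm (u b - u a) \<le> F (u a) - F (u b) \<and> \<kappa> * (b - a) \<le> norm (u b - u a)"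
    by (metis less_imp_le)
  have "\<forall>\<^sub>F a in nhds x. F (u a) < c0 + 2 * (F (u x) - c0)"
    by (rule order_tendstoD(2)[OF isCont_imp_tendsto_nhds[OF isCont_F_u[OF x]]]) (use f in simp)
  then obtain d2 where d2: "d2 > 0" "\<And>a. \<bar>a - x\<bar> < d2 \<Longrightarrow> F (u a) < c0 + 2 * (F (u x) - c0)"
    unfolding eventually_nhds_metric dist_real_def by blast
  show ?thesis
  proof (intro exI[of _ "min d1 d2"] conjI allI impI)
    fix a b assume ab: "\<bar>a - x\<bar> < min d1 d2" "\<bar>b - x\<bar> < min d1 d2" "a \<le> b"
    show "F (u a) - c0 \<le> 2 * (F (u x) - c0)" using d2(2)[of a] ab by simp
    have 1: "\<kappa> * norm (u b - u a) \<le> F (u a) - F (u b)" "\<kappa> * (b - a) \<le> norm (u b - u a)"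
      using d1(2)[of a b] ab by auto
    show "\<kappa> * norm (u b - u a) \<le> F (u a) - F (u b)" by (rule 1)
    have "\<kappa>\<^sup>2 * (b - a) \<le> \<kappa> * norm (u b - u a)"
      using mult_left_mono[OF 1(2), of \<kappa>] \<kappa>0 by (simp add: power2_eq_square mult.assoc)
    with 1 show "\<kappa>\<^sup>2 * (b - a) \<le> F (u a) - F (u b)" by simp
    have "0 \<le> \<kappa> * norm (u b - u a)" using \<kappa>0 by simp
    with 1(1) show "F (u b) \<le> F (u a)" by linarith
  qed (use d1 d2 in auto)
qed

text \<open>The differential inequalities for \<open>f\<^sup>\<gamma>\<close>, \<open>f powr (-(1 - 2 * \<gamma>))\<close> and \<open>ln f\<close>, where \<open>f\<close> is the
  energy above \<open>c0\<close>, on short intervals around \<open>x\<close>. There \<open>f\<close> is at most twice its value at \<open>x\<close>; this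
  factor and the one in \<open>\<kappa>\<close> account for the constants. The three quantities are additive in time, which is what
  extends the estimates to long intervals.\<close>
lemma local_estimates:
  assumes x: "0 < x" and f: "c0 < F (u x)"
    and Loj: "(F (u x) - c0) powr (1 - \<gamma>) \<le> C * constrained_grad_norm K G (u x)"
  shows "\<exists>d>0. \<forall>a b. a \<le> x \<and> x \<le> b \<and> b - a < d \<longrightarrow> c0 < F (u b) \<longrightarrow>
     \<gamma> / (4 * C) * norm (u b - u a) \<le> (F (u a) - c0) powr \<gamma> - (F (u b) - c0) powr \<gamma> \<and>
     (\<gamma> < 1/2 \<longrightarrow> (1 - 2 * \<gamma>) / (16 * C\<^sup>2) * (b - a)
         \<le> (F (u b) - c0) powr (- (1 - 2 * \<gamma>)) - (F (u a) - c0) powr (- (1 - 2 * \<gamma>))) \<and>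
     (\<gamma> = 1/2 \<longrightarrow> 1 / (8 * C\<^sup>2) * (b - a) \<le> ln (F (u a) - c0) - ln (F (u b) - c0))"
proof -
  define X where "X = F (u x) - c0"
  have X: "0 < X" using f by (simp add: X_def)
  define \<kappa> where "\<kappa> = X powr (1 - \<gamma>) / (2 * C)"
  have \<kappa>2: "\<kappa>\<^sup>2 = X powr (2 - 2 * \<gamma>) / (4 * C\<^sup>2)"
    using X by (simp add: \<kappa>_def power_divide power_mult_distrib powr_power)
  \<comment> \<open>The powers of \<open>X\<close> from the slope and from the derivative of \<open>f\<^sup>p\<close> are exactly inverse to each other.\<close>
  have cancel: "2 powr (- r) * (1 / c) = (2 * X) powr (- r) * (X powr r / c)" for r c
    using X by (simp add: powr_mult powr_minus field_simps)
  obtain d where d: "d > 0" "\<And>a b. \<bar>a - x\<bar> < d \<Longrightarrow> \<bar>b - x\<bar> < d \<Longrightarrow> a \<le> b \<Longrightarrow>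
     F (u a) - c0 \<le> 2 * X \<and> F (u b) \<le> F (u a) \<and>
     \<kappa> * norm (u b - u a) \<le> F (u a) - F (u b) \<and> \<kappa>\<^sup>2 * (b - a) \<le> F (u a) - F (u b)"
    using local_energy_drop[OF x f Loj] unfolding X_def \<kappa>_def by blast
  show ?thesis
  proof (intro exI[of _ d] conjI d(1) allI impI)
    fix a b assume ab: "a \<le> x \<and> x \<le> b \<and> b - a < d" and fb: "c0 < F (u b)"
    define A B where "A = F (u a) - c0" and "B = F (u b) - c0"
    have AB: "A \<le> 2 * X" "B \<le> A" "\<kappa> * norm (u b - u a) \<le> A - B" "\<kappa>\<^sup>2 * (b - a) \<le> A - B"
      using d(2)[of a b] ab by (auto simp: A_def B_def)
    have B: "0 < B" using fb by (simp add: B_def)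
    have conc: "(2 * X) powr (p - 1) * D \<le> (A powr p - B powr p) / p"
      if "D \<le> A - B" "0 \<le> D" "p \<noteq> 0" "p \<le> 1" for p D
    proof -
      have "(2 * X) powr (p - 1) * D \<le> A powr (p - 1) * (A - B)"
        using that AB B by (intro mult_mono powr_mono2') auto
      also have "\<dots> \<le> (A powr p - B powr p) / p" by (rule powr_difference_quotient_ge) (use that AB B in auto)
      finally show ?thesis .
    qed
    have \<kappa>0: "0 \<le> \<kappa>" using C by (simp add: \<kappa>_def)
    show "\<gamma> / (4 * C) * norm (u b - u a) \<le> (F (u a) - c0) powr \<gamma> - (F (u b) - c0) powr \<gamma>"
    proof -
      have "(1/2) * (1 / (2 * C)) \<le> 2 powr (- (1 - \<gamma>)) * (1 / (2 * C))"
        using powr_mono[of "-1" "- (1 - \<gamma>)" 2] \<gamma> C by (intro mult_right_mono) (auto simp: powr_minus)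
      also have "\<dots> = (2 * X) powr (\<gamma> - 1) * \<kappa>" unfolding cancel \<kappa>_def by simp
      finally have "1 / (4 * C) * norm (u b - u a) \<le> (2 * X) powr (\<gamma> - 1) * \<kappa> * norm (u b - u a)"
        by (intro mult_right_mono) auto
      also have "\<dots> \<le> (A powr \<gamma> - B powr \<gamma>) / \<gamma>"
        using conc[OF AB(3), of \<gamma>] \<kappa>0 \<gamma> by (simp add: mult.assoc)
      finally show ?thesis using \<gamma> by (simp add: A_def B_def field_simps)
    qed
    have D0: "0 \<le> \<kappa>\<^sup>2 * (b - a)" using ab by simp
    show "(1 - 2 * \<gamma>) / (16 * C\<^sup>2) * (b - a)
         \<le> (F (u b) - c0) powr (- (1 - 2 * \<gamma>)) - (F (u a) - c0) powr (- (1 - 2 * \<gamma>))" if g: "\<gamma> < 1/2"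
    proof -
      define p where "p = - (1 - 2 * \<gamma>)"
      have p: "p < 0" "p - 1 = - (2 - 2 * \<gamma>)" using g by (auto simp: p_def)
      have "(1/4) * (1 / (4 * C\<^sup>2)) \<le> 2 powr (- (2 - 2 * \<gamma>)) * (1 / (4 * C\<^sup>2))"
        using powr_mono[of "-2" "- (2 - 2 * \<gamma>)" 2] \<gamma> C by (intro mult_right_mono) (auto simp: powr_minus)
      also have "\<dots> = (2 * X) powr (p - 1) * \<kappa>\<^sup>2" unfolding cancel \<kappa>2 p(2) by simp
      finally have "1 / (16 * C\<^sup>2) * (b - a) \<le> (2 * X) powr (p - 1) * \<kappa>\<^sup>2 * (b - a)"
        using ab by (intro mult_right_mono) auto
      also have "\<dots> \<le> (A powr p - B powr p) / p"
        using conc[OF AB(4) D0, of p] p(1) by (simp add: mult.assoc)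
      finally have "(- p) * (1 / (16 * C\<^sup>2) * (b - a)) \<le> (- p) * ((A powr p - B powr p) / p)"
        using p(1) by (intro mult_left_mono) auto
      moreover have "(- p) * ((A powr p - B powr p) / p) = B powr p - A powr p"
        using p(1) by (simp add: field_simps)
      ultimately have "(- p) * (1 / (16 * C\<^sup>2) * (b - a)) \<le> B powr p - A powr p" by simp
      then show ?thesis by (simp add: A_def B_def p_def)
    qed
    show "1 / (8 * C\<^sup>2) * (b - a) \<le> ln (F (u a) - c0) - ln (F (u b) - c0)" if g: "\<gamma> = 1/2"
    proof -
      have A: "0 < A" using AB B by simp
      have "X / (4 * C\<^sup>2) * (b - a) \<le> A - B" using AB(4) X unfolding \<kappa>2 g by simp
      moreover have "A * (1 / (8 * C\<^sup>2) * (b - a)) \<le> 2 * X * (1 / (8 * C\<^sup>2) * (b - a))"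
        using ab by (intro mult_right_mono AB(1)) auto
      moreover have "2 * X * (1 / (8 * C\<^sup>2) * (b - a)) = X / (4 * C\<^sup>2) * (b - a)" by simp
      ultimately have "A * (1 / (8 * C\<^sup>2) * (b - a)) \<le> A - B" by linarith
      then have "1 / (8 * C\<^sup>2) * (b - a) \<le> (A - B) / A" using A by (simp add: pos_le_divide_eq mult.commute)
      also have "\<dots> \<le> ln A - ln B"
        using ln_le_minus_one[of "B / A"] A B by (simp add: ln_div diff_divide_distrib)
      finally show ?thesis by (simp add: A_def B_def)
    qed
  qed
qed

lemma Lojasiewicz_estimates:
  assumes s: "0 < s" "s \<le> t" and f: "\<And>r. r \<in> {s..t} \<Longrightarrow> c0 < F (u r)"
    and Loj: "\<And>r. r \<in> {s..t} \<Longrightarrow> (F (u r) - c0) powr (1 - \<gamma>) \<le> C * constrained_grad_norm K G (u r)"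
  shows "\<gamma> / (4 * C) * norm (u t - u s) \<le> (F (u s) - c0) powr \<gamma> - (F (u t) - c0) powr \<gamma>"
    and "\<gamma> < 1/2 \<Longrightarrow> (1 - 2 * \<gamma>) / (16 * C\<^sup>2) * (t - s)
         \<le> (F (u t) - c0) powr (- (1 - 2 * \<gamma>)) - (F (u s) - c0) powr (- (1 - 2 * \<gamma>))"
    and "\<gamma> = 1/2 \<Longrightarrow> 1 / (8 * C\<^sup>2) * (t - s) \<le> ln (F (u s) - c0) - ln (F (u t) - c0)"
proof -
  define P where "P a b \<longleftrightarrow>
     \<gamma> / (4 * C) * norm (u b - u a) \<le> (F (u a) - c0) powr \<gamma> - (F (u b) - c0) powr \<gamma> \<and>
     (\<gamma> < 1/2 \<longrightarrow> (1 - 2 * \<gamma>) / (16 * C\<^sup>2) * (b - a)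
         \<le> (F (u b) - c0) powr (- (1 - 2 * \<gamma>)) - (F (u a) - c0) powr (- (1 - 2 * \<gamma>))) \<and>
     (\<gamma> = 1/2 \<longrightarrow> 1 / (8 * C\<^sup>2) * (b - a) \<le> ln (F (u a) - c0) - ln (F (u b) - c0))" for a b
  have P_trans: "P a c" if "P a b" "P b c" for a b c
  proof -
    have "norm (u c - u a) \<le> norm (u c - u b) + norm (u b - u a)"
      using norm_triangle_ineq[of "u c - u b" "u b - u a"] by simp
    then have "\<gamma> / (4 * C) * norm (u c - u a) \<le> \<gamma> / (4 * C) * norm (u c - u b) + \<gamma> / (4 * C) * norm (u b - u a)"
      unfolding distrib_left[symmetric] using C \<gamma> by (intro mult_left_mono) auto
    note disp = this
    have time: "k * (c - a) = k * (b - a) + k * (c - b)" for k :: real by (simp add: algebra_simps)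
    show ?thesis
      unfolding P_def
    proof (intro conjI impI)
      show "\<gamma> / (4 * C) * norm (u c - u a) \<le> (F (u a) - c0) powr \<gamma> - (F (u c) - c0) powr \<gamma>"
        using disp that[unfolded P_def, THEN conjunct1] by linarith
      assume "\<gamma> < 1/2"
      then show "(1 - 2 * \<gamma>) / (16 * C\<^sup>2) * (c - a)
         \<le> (F (u c) - c0) powr (- (1 - 2 * \<gamma>)) - (F (u a) - c0) powr (- (1 - 2 * \<gamma>))"
        using that[unfolded P_def, THEN conjunct2, THEN conjunct1, rule_format] unfolding time by linarith
    next
      assume "\<gamma> = 1/2"
      then show "1 / (8 * C\<^sup>2) * (c - a) \<le> ln (F (u a) - c0) - ln (F (u c) - c0)"
        using that[unfolded P_def, THEN conjunct2, THEN conjunct2, rule_format] unfolding time by linarith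
    qed
  qed
  have "t \<le> t \<longrightarrow> s \<le> s \<longrightarrow> P s t"
    using s(2)
  proof (induction rule: Bolzano[where P="\<lambda>a b. b \<le> t \<longrightarrow> s \<le> a \<longrightarrow> P a b"])
    case (trans a b c)
    then show ?case using P_trans by force
  next
    case (local x)
    then have x: "x \<in> {s..t}" "0 < x" using s by auto
    from local_estimates[OF x(2) f[OF x(1)] Loj[OF x(1)]]
    obtain d where d: "d > 0" "\<And>a b. a \<le> x \<and> x \<le> b \<and> b - a < d \<Longrightarrow> c0 < F (u b) \<Longrightarrow> P a b"
      unfolding P_def by blast
    show ?case
    proof (intro exI[of _ d] conjI d(1) allI impI)
      fix a b assume "a \<le> x \<and> x \<le> b \<and> b - a < d" "b \<le> t" "s \<le> a"
      moreover from this have "c0 < F (u b)" by (intro f) auto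
      ultimately show "P a b" using d(2) by blast
    qed
  qed
  then have "P s t" by simp
  then show "\<gamma> / (4 * C) * norm (u t - u s) \<le> (F (u s) - c0) powr \<gamma> - (F (u t) - c0) powr \<gamma>"
    and "\<gamma> < 1/2 \<Longrightarrow> (1 - 2 * \<gamma>) / (16 * C\<^sup>2) * (t - s)
         \<le> (F (u t) - c0) powr (- (1 - 2 * \<gamma>)) - (F (u s) - c0) powr (- (1 - 2 * \<gamma>))"
    and "\<gamma> = 1/2 \<Longrightarrow> 1 / (8 * C\<^sup>2) * (t - s) \<le> ln (F (u s) - c0) - ln (F (u t) - c0)"
    unfolding P_def by blast+
qed

text \<open>Discarding the nonnegative term at time \<open>t\<close> makes the bound independent of \<open>t\<close>; this is what gives
  confinement and convergence.\<close>
lemma displacement_le: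
  assumes s: "0 < s" "s \<le> t" and f: "\<And>r. r \<in> {s..t} \<Longrightarrow> c0 < F (u r)"
    and Loj: "\<And>r. r \<in> {s..t} \<Longrightarrow> (F (u r) - c0) powr (1 - \<gamma>) \<le> C * constrained_grad_norm K G (u r)"
  shows "norm (u t - u s) \<le> 4 * C / \<gamma> * (F (u s) - c0) powr \<gamma>"
proof -
  have "\<gamma> / (4 * C) * norm (u t - u s) \<le> (F (u s) - c0) powr \<gamma> - (F (u t) - c0) powr \<gamma>"
    by (rule Lojasiewicz_estimates(1)[OF s]) (use f Loj in auto)
  then have "\<gamma> / (4 * C) * norm (u t - u s) \<le> (F (u s) - c0) powr \<gamma>" by (simp add: order_trans)
  then show ?thesis using C \<gamma> by (simp add: field_simps)
qed

text \<open>The length bound confines the trajectory: until the first exit time from the ball it applies,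
  and the distance travelled is too small to reach the boundary. The trajectory is controlled only at
  positive times, so the bound is carried to the initial time by continuity.\<close>
lemma stays_in_ball:
  assumes cont: "continuous_on {0..} u"
    and f: "\<And>t. 0 < t \<Longrightarrow> c0 < F (u t)" "\<And>t. 0 < t \<Longrightarrow> F (u t) - c0 \<le> E"
    and Loj: "\<And>t. 0 < t \<Longrightarrow> norm (u t - \<psi>) \<le> R \<Longrightarrow>
        (F (u t) - c0) powr (1 - \<gamma>) \<le> C * constrained_grad_norm K G (u t)"
    and start: "norm (u 0 - \<psi>) + 4 * C / \<gamma> * E powr \<gamma> < R" and t: "0 \<le> t"
  shows "norm (u t - \<psi>) < R"
proof (rule ccontr)
  assume "\<not> norm (u t - \<psi>) < R"
  define S where "S = {r \<in> {0..}. R \<le> norm (u r - \<psi>)}"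
  have "closed S" unfolding S_def
    by (intro continuous_on_closed_Collect_le continuous_intros cont closed_atLeast)
  moreover have "t \<in> S" using t \<open>\<not> norm (u t - \<psi>) < R\<close> by (simp add: S_def)
  moreover have bdd: "bdd_below S" by (rule bdd_belowI[of _ 0]) (simp add: S_def)
  ultimately have \<tau>: "Inf S \<in> S" by (intro closed_contains_Inf) auto
  define \<tau> where "\<tau> = Inf S"
  define D where "D = 4 * C / \<gamma> * E powr \<gamma>"
  have D: "0 \<le> D" using C \<gamma> by (simp add: D_def)
  have before: "norm (u r - \<psi>) < R" if "0 \<le> r" "r < \<tau>" for r
  proof (rule ccontr)
    assume "\<not> norm (u r - \<psi>) < R"
    then have "r \<in> S" using that by (simp add: S_def)
    then have "\<tau> \<le> r" unfolding \<tau>_def by (rule cInf_lower[OF _ bdd])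
    with that show False by simp
  qed
  have R\<tau>: "0 \<le> \<tau>" "R \<le> norm (u \<tau> - \<psi>)" using \<tau> by (auto simp: S_def \<tau>_def)
  moreover have "norm (u 0 - \<psi>) < R" using start D by (simp add: D_def)
  ultimately have \<tau>0: "0 < \<tau>" by (cases "\<tau> = 0") auto
  have 1: "norm (u r - u s) \<le> D" if "0 < s" "s \<le> r" "r < \<tau>" for s r
  proof -
    have "norm (u r - u s) \<le> 4 * C / \<gamma> * (F (u s) - c0) powr \<gamma>"
      using that before by (intro displacement_le f Loj) (auto intro: less_imp_le)
    also have "\<dots> \<le> D" unfolding D_def
      using that f[of s] C \<gamma> by (intro mult_left_mono powr_mono2) auto
    finally show ?thesis .
  qed
  have lim0: "(u \<longlongrightarrow> u 0) (at_right 0)"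
    using cont unfolding continuous_on_def by (auto intro: tendsto_within_subset)
  have lim\<tau>: "(u \<longlongrightarrow> u \<tau>) (at_left \<tau>)"
    using isCont_u[OF \<tau>0] unfolding isCont_def by (auto intro: tendsto_within_subset)
  have 2: "norm (u r - u 0) \<le> D" if "0 < r" "r < \<tau>" for r
  proof (rule tendsto_upperbound)
    show "((\<lambda>s. norm (u r - u s)) \<longlongrightarrow> norm (u r - u 0)) (at_right 0)"
      by (intro tendsto_intros lim0)
    show "\<forall>\<^sub>F s in at_right 0. norm (u r - u s) \<le> D"
      by (rule eventually_at_rightI[of 0 r]) (use that 1 in auto)
  qed simp
  have "norm (u \<tau> - u 0) \<le> D"
  proof (rule tendsto_upperbound)
    show "((\<lambda>r. norm (u r - u 0)) \<longlongrightarrow> norm (u \<tau> - u 0)) (at_left \<tau>)"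
      by (intro tendsto_intros lim\<tau>)
    show "\<forall>\<^sub>F r in at_left \<tau>. norm (u r - u 0) \<le> D"
      by (rule eventually_at_leftI[of 0 \<tau>]) (use 2 \<tau>0 in auto)
  qed simp
  then show False using R\<tau>(2) start norm_triangle_ineq[of "u \<tau> - u 0" "u 0 - \<psi>"] by (simp add: D_def)
qed

text \<open>The decay inequalities integrated from \<open>s\<close> to \<open>t\<close>, with \<open>s\<close> tending to \<open>0\<close>.\<close>
lemma energy_decay:
  assumes f: "\<And>r. 0 < r \<Longrightarrow> c0 < F (u r)" "\<And>r. 0 < r \<Longrightarrow> F (u r) - c0 \<le> E"
    and Loj: "\<And>r. 0 < r \<Longrightarrow> (F (u r) - c0) powr (1 - \<gamma>) \<le> C * constrained_grad_norm K G (u r)"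
    and t: "0 < t"
  shows "\<gamma> < 1/2 \<Longrightarrow> F (u t) - c0 \<le> ((1 - 2 * \<gamma>) / (16 * C\<^sup>2) * t) powr (- (1 / (1 - 2 * \<gamma>)))"
    and "\<gamma> = 1/2 \<Longrightarrow> F (u t) - c0 \<le> E * exp (- (1 / (8 * C\<^sup>2) * t))"
proof -
  have to_zero: "k * t \<le> B" if "\<And>s. 0 < s \<Longrightarrow> s \<le> t \<Longrightarrow> k * (t - s) \<le> B" for k B :: real
  proof (rule tendsto_upperbound)
    show "((\<lambda>s. k * (t - s)) \<longlongrightarrow> k * t) (at_right 0)" by (auto intro!: tendsto_eq_intros)
    show "\<forall>\<^sub>F s in at_right 0. k * (t - s) \<le> B"
      by (rule eventually_at_rightI[of 0 t]) (use that t in auto)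
  qed simp
  define Y where "Y = F (u t) - c0"
  have Y: "0 < Y" using f t by (simp add: Y_def)
  show "F (u t) - c0 \<le> ((1 - 2 * \<gamma>) / (16 * C\<^sup>2) * t) powr (- (1 / (1 - 2 * \<gamma>)))" if g: "\<gamma> < 1/2"
  proof -
    define m where "m = 1 - 2 * \<gamma>"
    have m: "0 < m" using g by (simp add: m_def)
    have "m / (16 * C\<^sup>2) * t \<le> Y powr (- m)"
    proof (rule to_zero)
      fix s assume s: "0 < s" "s \<le> t"
      have "m / (16 * C\<^sup>2) * (t - s) \<le> Y powr (- m) - (F (u s) - c0) powr (- m)"
        unfolding m_def Y_def by (rule Lojasiewicz_estimates(2)[OF s _ _ g]) (use s f Loj in auto)
      then show "m / (16 * C\<^sup>2) * (t - s) \<le> Y powr (- m)" by (simp add: order_trans)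
    qed
    then have "(Y powr (- m)) powr (- (1 / m)) \<le> (m / (16 * C\<^sup>2) * t) powr (- (1 / m))"
      using m C t by (intro powr_mono2') auto
    moreover have "(Y powr (- m)) powr (- (1 / m)) = Y" using m Y by (simp add: powr_powr)
    ultimately show ?thesis by (simp add: Y_def m_def)
  qed
  show "F (u t) - c0 \<le> E * exp (- (1 / (8 * C\<^sup>2) * t))" if g: "\<gamma> = 1/2"
  proof -
    have E: "0 < E" using f[OF t] by simp
    have "1 / (8 * C\<^sup>2) * t \<le> ln E - ln Y"
    proof (rule to_zero)
      fix s assume s: "0 < s" "s \<le> t"
      have "1 / (8 * C\<^sup>2) * (t - s) \<le> ln (F (u s) - c0) - ln Y"
        unfolding Y_def by (rule Lojasiewicz_estimates(3)[OF s _ _ g]) (use s f Loj in auto)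
      also have "ln (F (u s) - c0) \<le> ln E" using f[OF s(1)] E by simp
      finally show "1 / (8 * C\<^sup>2) * (t - s) \<le> ln E - ln Y" by simp
    qed
    then have "ln Y \<le> ln E + - (1 / (8 * C\<^sup>2) * t)" by simp
    then have "exp (ln Y) \<le> exp (ln E + - (1 / (8 * C\<^sup>2) * t))" by (simp only: exp_le_cancel_iff)
    then show ?thesis using Y E by (simp only: exp_add exp_ln Y_def)
  qed
qed

end
end

section \<open>Translation in time and the limit point\<close>

lemma simple_function_lebesgue_shift:
  assumes "simple_function lebesgue s"
  shows "simple_function lebesgue (\<lambda>t::real. s (\<tau> + t))"
proof -
  have T: "(\<lambda>t. \<tau> + t) \<in> lebesgue \<rightarrow>\<^sub>M (lebesgue :: real measure)"
    using lebesgue_affine_measurable[where c="\<lambda>x::real. 1" and t=\<tau>] by simp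
  show ?thesis
    unfolding simple_function_def
  proof (intro conjI ballI)
    have "(\<lambda>t. s (\<tau> + t)) ` space lebesgue \<subseteq> s ` space lebesgue" by auto
    then show "finite ((\<lambda>t. s (\<tau> + t)) ` space lebesgue)"
      using assms finite_subset unfolding simple_function_def by blast
    fix x
    have "s -` {x} \<inter> space lebesgue \<in> sets lebesgue"
    proof (cases "x \<in> s ` space lebesgue")
      case True
      then show ?thesis using assms unfolding simple_function_def by blast
    next
      case False
      then have "s -` {x} \<inter> space lebesgue = {}" by auto
      then show ?thesis by simp
    qed
    from measurable_sets[OF T this]
    show "(\<lambda>t. s (\<tau> + t)) -` {x} \<inter> space lebesgue \<in> sets lebesgue"
      by (simp add: vimage_def)
  qed
qed

lemma AE_lebesgue_shift:
  fixes \<tau> :: real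
  assumes "AE t in lebesgue. P t"
  shows "AE t in lebesgue. P (\<tau> + t)"
proof -
  from assms obtain Z where Z: "negligible Z" "\<And>t. t \<notin> Z \<Longrightarrow> P t"
    unfolding eventually_ae_filter_negligible by auto
  have "{t. \<not> P (\<tau> + t)} \<subseteq> (+) (- \<tau>) ` Z"
  proof
    fix t assume "t \<in> {t. \<not> P (\<tau> + t)}"
    then have "\<tau> + t \<in> Z" using Z(2) by auto
    then show "t \<in> (+) (- \<tau>) ` Z" by (rule rev_image_eqI) simp
  qed
  then show ?thesis
    unfolding eventually_ae_filter_negligible
    by (intro exI[of _ "(+) (- \<tau>) ` Z"] conjI negligible_translation Z(1))
qed

lemma shifted_Icc_subset:
  fixes a b \<tau> :: real
  assumes "{a..b} \<subseteq> {0<..}" "0 \<le> \<tau>"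
  shows "{a + \<tau>..b + \<tau>} \<subseteq> {0<..}"
proof
  fix x assume "x \<in> {a + \<tau>..b + \<tau>}"
  then have "x - \<tau> \<in> {a..b}" by auto
  then have "x - \<tau> \<in> {0<..}" using assms(1) by blast
  then show "x \<in> {0<..}" using assms(2) by simp
qed

lemma L2_loc_shift:
  fixes f :: "real \<Rightarrow> 'h::real_normed_vector"
  assumes f: "L2_loc {0<..} f" and \<tau>: "0 \<le> \<tau>"
  shows "L2_loc {0<..} (\<lambda>t. f (\<tau> + t))"
  unfolding L2_loc_def
proof (intro conjI allI impI)
  note f' = f[unfolded L2_loc_def]
  obtain s where "(\<forall>n::nat. simple_function lebesgue (s n)) \<and>
      (AE t in lebesgue. t \<in> {0<..} \<longrightarrow> (\<lambda>n. s n t) \<longlonglongrightarrow> f t)"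
    by (rule exE[OF f'[THEN conjunct1]])
  then have s: "\<And>n. simple_function lebesgue (s n)"
    and lim: "AE t in lebesgue. t \<in> {0<..} \<longrightarrow> (\<lambda>n. s n t) \<longlonglongrightarrow> f t"
    by simp_all
  have "AE t in lebesgue. t \<in> {0<..} \<longrightarrow> (\<lambda>n. s n (\<tau> + t)) \<longlonglongrightarrow> f (\<tau> + t)"
    by (rule eventually_mono[OF AE_lebesgue_shift[OF lim, of \<tau>]]) (use \<tau> in auto)
  with s show "\<exists>s. (\<forall>n::nat. simple_function lebesgue (s n)) \<and>
      (AE t in lebesgue. t \<in> {0<..} \<longrightarrow> (\<lambda>n. s n t) \<longlonglongrightarrow> f (\<tau> + t))"
    by (intro exI[of _ "\<lambda>n t. s n (\<tau> + t)"] conjI allI simple_function_lebesgue_shift)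
  fix a b :: real assume ab: "{a..b} \<subseteq> {0<..}"
  then have "{a + \<tau>..b + \<tau>} \<subseteq> {0<..}" using \<tau> by (rule shifted_Icc_subset)
  then have "set_integrable lebesgue {a + \<tau>..b + \<tau>} (\<lambda>t. (norm (f t))\<^sup>2)"
    using f'[THEN conjunct2] by blast
  then have "(\<lambda>t. (norm (f t))\<^sup>2) integrable_on {a + \<tau>..b + \<tau>}"
    by (rule set_lebesgue_integral_eq_integral(1))
  then have "(\<lambda>t. (norm (f (\<tau> + t)))\<^sup>2) integrable_on {a..b}"
    using has_integral_shift_Icc_real[of "\<lambda>t. (norm (f t))\<^sup>2" \<tau>] unfolding integrable_on_def o_def by blast
  then show "set_integrable lebesgue {a..b} (\<lambda>t. (norm (f (\<tau> + t)))\<^sup>2)"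
    by (subst absolutely_integrable_on_iff_nonneg) auto
qed

lemma weak_derivative_on_shift:
  fixes f g :: "real \<Rightarrow> 'h::real_normed_vector"
  assumes fg: "weak_derivative_on {0<..} f g" and \<tau>: "0 \<le> \<tau>"
  shows "weak_derivative_on {0<..} (\<lambda>t. f (\<tau> + t)) (\<lambda>t. g (\<tau> + t))"
  unfolding weak_derivative_on_def
proof (intro allI impI)
  fix \<psi> \<psi>' :: "real \<Rightarrow> real" and a b :: real
  assume ab: "{a..b} \<subseteq> {0<..}" and \<psi>: "\<forall>t. (\<psi> has_real_derivative \<psi>' t) (at t)"
    "continuous_on UNIV \<psi>'" "\<forall>t. t \<notin> {a..b} \<longrightarrow> \<psi> t = 0"
  have 1: "{a + \<tau>..b + \<tau>} \<subseteq> {0<..}" using ab \<tau> by (rule shifted_Icc_subset)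
  have 2: "\<forall>t. ((\<lambda>t. \<psi> (t + - \<tau>)) has_real_derivative \<psi>' (t + - \<tau>)) (at t)"
    unfolding DERIV_shift[symmetric] using \<psi>(1) by blast
  have 3: "continuous_on UNIV (\<lambda>t. \<psi>' (t + - \<tau>))"
    by (intro continuous_on_compose2[OF \<psi>(2)] continuous_intros) auto
  have 4: "\<forall>t. t \<notin> {a + \<tau>..b + \<tau>} \<longrightarrow> \<psi> (t + - \<tau>) = 0" using \<psi>(3) by auto
  obtain J where J: "((\<lambda>t. \<psi>' (t + - \<tau>) *\<^sub>R f t) has_integral J) {a + \<tau>..b + \<tau>}"
    "((\<lambda>t. \<psi> (t + - \<tau>) *\<^sub>R g t) has_integral (- J)) {a + \<tau>..b + \<tau>}"
    using fg[unfolded weak_derivative_on_def, rule_format, OF 1 _ 3] 2 4 by blast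
  from this[folded has_integral_shift_Icc_real]
  show "\<exists>J. ((\<lambda>t. \<psi>' t *\<^sub>R f (\<tau> + t)) has_integral J) {a..b} \<and>
      ((\<lambda>t. \<psi> t *\<^sub>R g (\<tau> + t)) has_integral - J) {a..b}"
    unfolding o_def by auto
qed

lemma strong_solution_shift:
  assumes sol: "strong_solution W nW K G u0 \<infinity> u" and \<tau>: "0 \<le> \<tau>"
  shows "strong_solution W nW K G (u \<tau>) \<infinity> (\<lambda>t. u (\<tau> + t))"
proof -
  have pos: "{t::real. 0 < t \<and> ereal t < \<infinity>} = {0<..}" and nn: "{t::real. 0 \<le> t \<and> ereal t < \<infinity>} = {0..}" by auto
  note sol' = sol[unfolded strong_solution_def pos nn]
  have inK: "\<And>t. 0 \<le> t \<Longrightarrow> u t \<in> K" and cont: "continuous_on {0..} u"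
    and cm: "continuous_map (top_of_set {0<..}) (subtopology (W_topology W nW) (W \<inter> K)) u"
    using sol' by auto
  obtain u' where H: "H1_loc_with_derivative {0<..} u u'"
    and vi: "\<And>v. v \<in> K \<Longrightarrow> AE t in lebesgue. 0 < t \<longrightarrow> 0 \<le> (u' t + G (u t)) \<bullet> (v - u t)"
    using sol' by auto
  show ?thesis
    unfolding strong_solution_def pos nn
  proof (intro conjI exI[of _ "\<lambda>t. u' (\<tau> + t)"] ballI allI impI)
    show "continuous_on {0..} (\<lambda>t. u (\<tau> + t))"
      by (intro continuous_on_compose2[OF cont] continuous_intros) (use \<tau> in auto)
    have "continuous_map (top_of_set {0<..}) (top_of_set {0<..}) (\<lambda>t. \<tau> + t)"
      using \<tau> by (auto intro!: continuous_intros)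
    from continuous_map_compose[OF this cm]
    show "continuous_map (top_of_set {0<..}) (subtopology (W_topology W nW) (W \<inter> K)) (\<lambda>t. u (\<tau> + t))"
      by (simp add: o_def)
    show "H1_loc_with_derivative {0<..} (\<lambda>t. u (\<tau> + t)) (\<lambda>t. u' (\<tau> + t))"
      using H \<tau> unfolding H1_loc_with_derivative_def by (blast intro: L2_loc_shift weak_derivative_on_shift)
    show "AE t in lebesgue. 0 < t \<and> ereal t < \<infinity> \<longrightarrow> 0 \<le> (u' (\<tau> + t) + G (u (\<tau> + t))) \<bullet> (v - u (\<tau> + t))"
      if "v \<in> K" for v
      by (rule eventually_mono[OF AE_lebesgue_shift[OF vi[OF that], of \<tau>]]) (use \<tau> in auto)
  qed (use inK \<tau> in auto)
qed

text \<open>The limit \<open>l\<close> is a rest point of the flow: restarting \<open>u\<close> at a late time gives solutions whose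
  initial data tend to \<open>l\<close> and whose values after any further time \<open>s\<close> also tend to \<open>l\<close>. By continuous
  dependence the solution \<open>v\<close> from \<open>l\<close> satisfies \<open>v s = l\<close>, and solutions lie in \<open>W\<close> at positive times.\<close>
lemma limit_of_global_solution_in_W:
  fixes K :: "'h::{real_inner,complete_space} set"
  assumes dep: "flow_depends_continuously_on W nW K G N"
    and sol: "strong_solution W nW K G u0 \<infinity> u"
    and lim: "(u \<longlongrightarrow> l) at_top" and l: "l \<in> N \<inter> K" and ev: "\<forall>\<^sub>F t in at_top. u t \<in> N"
  shows "l \<in> W"
proof -
  obtain T v where v: "strong_solution W nW K G l T v"
    using dep[unfolded flow_depends_continuously_on_def, THEN conjunct1] l by blast
  have "0 < T" using v unfolding strong_solution_def by blast
  then obtain s where s: "0 < s" "ereal s < T" using ereal_dense2[of 0 T] by auto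
  have "continuous_map (top_of_set {t. 0 < t \<and> ereal t < T}) (subtopology (W_topology W nW) (W \<inter> K)) v"
    using v unfolding strong_solution_def by blast
  then have "v s \<in> W" using s unfolding continuous_map_in_subtopology by auto
  moreover have "norm (l - v s) \<le> 0"
  proof (rule field_le_epsilon)
    fix e :: real assume e: "0 < e"
    obtain \<delta> where \<delta>: "\<delta> > 0" "\<And>u0 v0 T1 u T2 v. u0 \<in> N \<inter> K \<Longrightarrow> v0 \<in> N \<inter> K \<Longrightarrow> norm (u0 - v0) \<le> \<delta> \<Longrightarrow>
        strong_solution W nW K G u0 T1 u \<Longrightarrow> strong_solution W nW K G v0 T2 v \<Longrightarrow>
        ereal s < T1 \<Longrightarrow> ereal s < T2 \<Longrightarrow> norm (u s - v s) \<le> e / 2"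
      using dep[unfolded flow_depends_continuously_on_def, THEN conjunct2, rule_format, OF s(1) half_gt_zero[OF e]] s(1)
      by (metis atLeastAtMost_iff less_imp_le order_refl)
    have "\<forall>\<^sub>F t in at_top. dist (u t) l < \<delta>" "\<forall>\<^sub>F t in at_top. dist (u t) l < e / 2"
      by (rule tendstoD[OF lim]; use \<delta>(1) e in simp)+
    with ev have "\<forall>\<^sub>F t in at_top. u t \<in> N \<and> dist (u t) l < \<delta> \<and> dist (u t) l < e / 2"
      by eventually_elim blast
    then obtain t0 where t0: "\<And>t. t0 \<le> t \<Longrightarrow> u t \<in> N \<and> dist (u t) l < \<delta> \<and> dist (u t) l < e / 2"
      unfolding eventually_at_top_linorder by blast
    define \<tau> where "\<tau> = max t0 0"
    have shift: "strong_solution W nW K G (u \<tau>) \<infinity> (\<lambda>t. u (\<tau> + t))"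
      by (rule strong_solution_shift[OF sol]) (simp add: \<tau>_def)
    have "u \<tau> \<in> K" using shift unfolding strong_solution_def by blast
    then have "norm (u (\<tau> + s) - v s) \<le> e / 2"
      using t0[of \<tau>] l s by (intro \<delta>(2)[OF _ _ _ shift v]) (auto simp: \<tau>_def dist_norm)
    moreover have "dist (u (\<tau> + s)) l < e / 2" using t0[of "\<tau> + s"] s by (simp add: \<tau>_def)
    ultimately show "norm (l - v s) \<le> 0 + e"
      using norm_triangle_ineq[of "l - u (\<tau> + s)" "u (\<tau> + s) - v s"]
      by (simp add: dist_norm norm_minus_commute)
  qed
  ultimately show ?thesis by simp
qed

section \<open>Convergence with rates\<close>

theorem proposition2p10:
  fixes W K S S\<phi> N :: "'h::{real_inner,complete_space} set"
    and nW F :: "'h \<Rightarrow> real" and G :: "'h \<Rightarrow> 'h"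
    and \<phi> :: 'h and \<gamma> :: real
  assumes setting: "constrained_functional W nW K F G"
    and closed_K: "closed K"
    and S_critical: "S \<subseteq> {u \<in> W \<inter> K. critical_point W K G u}"
    and phi: "\<phi> \<in> S"
    and S\<phi>_def: "S\<phi> = {\<psi> \<in> S. F \<psi> = F \<phi>}"
    and nbhd: "neighborhood_in K S\<phi> N"
    and a: "flow_depends_continuously_on W nW K G N"
    and b: "constrained_Lojasiewicz W K F G S\<phi> \<gamma>"
  shows "\<exists>\<delta>>0. \<exists>E>0. \<exists>C>0. \<forall>u0 u.
    u0 \<in> K \<inter> W \<longrightarrow>
    strong_solution W nW K G u0 \<infinity> u \<longrightarrow>
    (\<forall>t>0. F (u t) \<le> F u0) \<longrightarrow>
    infdist u0 S\<phi> \<le> \<delta> \<longrightarrow>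
    F u0 - F \<phi> \<le> E \<longrightarrow>
    (\<forall>t>0. F (u t) > F \<phi>) \<longrightarrow>
    (\<exists>u_inf\<in>W \<inter> K.
       (u \<longlongrightarrow> u_inf) at_top \<and>
       (\<gamma> < 1/2 \<longrightarrow>
          (\<forall>t\<ge>1. norm (u t - u_inf) \<le> C * t powr (- (\<gamma> / (1 - 2 * \<gamma>))) \<and>
                 F (u t) - F \<phi> \<le> C * t powr (- (1 / (1 - 2 * \<gamma>))))) \<and>
       (\<gamma> = 1/2 \<longrightarrow>
          (\<forall>t\<ge>1. norm (u t - u_inf) \<le> exp (- C * t) \<and>
                 F (u t) - F \<phi> \<le> exp (- C * t))))"
proof -
  interpret constrained_functional W nW K F G by (rule setting)
  obtain d where d: "d > 0" "\<And>w. w \<in> K \<Longrightarrow> infdist w S\<phi> < d \<Longrightarrow> w \<in> N"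
    using nbhd unfolding neighborhood_in_def by blast
  have \<gamma>: "0 < \<gamma>" "\<gamma> \<le> 1/2" using b unfolding constrained_Lojasiewicz_def by auto
  obtain C \<delta>L EL where C: "C > 0" and \<delta>L: "\<delta>L > 0" and EL: "EL > 0"
    and Loj: "\<And>\<psi> w. \<psi> \<in> S\<phi> \<Longrightarrow> w \<in> K \<inter> W \<Longrightarrow> norm (w - \<psi>) \<le> \<delta>L \<Longrightarrow> F w - F \<psi> \<le> EL \<Longrightarrow>
        max 0 (F w - F \<psi>) powr (1 - \<gamma>) \<le> C * constrained_grad_norm K G w"
    using b unfolding constrained_Lojasiewicz_def by blast
  \<comment> \<open>Closer than \<open>R\<close> to a point of \<open>S\<phi>\<close> both hypotheses on the neighbourhood apply.\<close>
  define R where "R = min \<delta>L d"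
  define A where "A = 4 * C / \<gamma>"
  have R: "R > 0" using \<delta>L d by (simp add: R_def)
  have A: "A > 0" using C \<gamma> by (simp add: A_def)
  \<comment> \<open>Chosen so that the length bound \<open>A * E powr \<gamma>\<close> is at most \<open>R / 4\<close>, which confines the trajectory,
    and at most \<open>1\<close>, which is needed for the exponential bounds with no factor in front.\<close>
  define E where "E = min (min EL 1) ((min 1 (R / 4) / A) powr (1 / \<gamma>))"
  have E: "E > 0" "E \<le> EL" "E \<le> 1" using EL R A by (auto simp: E_def)
  have "E powr \<gamma> \<le> ((min 1 (R / 4) / A) powr (1 / \<gamma>)) powr \<gamma>"
    using E \<gamma> by (intro powr_mono2) (auto simp: E_def)
  also have "\<dots> = min 1 (R / 4) / A" using \<gamma> R A by (simp add: powr_powr)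
  finally have AE: "A * E powr \<gamma> \<le> min 1 (R / 4)" using A by (simp add: field_simps)
  define m where "m = 1 - 2 * \<gamma>"
  define k where "k = m / (16 * C\<^sup>2)"
  \<comment> \<open>The energy decays like \<open>exp (- 2 * C' * t)\<close> when \<open>\<gamma> = 1/2\<close>; its square root governs the distance.\<close>
  define C' where "C' = (if \<gamma> < 1/2 then max (A * k powr (- (\<gamma> / m))) (k powr (- (1 / m))) else 1 / (16 * C\<^sup>2))"
  have C': "C' > 0"
  proof (cases "\<gamma> < 1/2")
    case True
    then have "0 < k" using C by (simp add: k_def m_def)
    then show ?thesis using True by (simp add: C'_def less_max_iff_disj)
  qed (use C in \<open>simp add: C'_def\<close>)
  show ?thesis
  proof (rule exI[of _ "R / 4"], rule conjI, use R in simp, rule exI[of _ E], rule conjI, rule E,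
      rule exI[of _ C'], rule conjI, rule C', intro allI impI)
    fix u0 u
    assume u0: "u0 \<in> K \<inter> W" and sol: "strong_solution W nW K G u0 \<infinity> u"
      and mono: "\<forall>t>0. F (u t) \<le> F u0" and dist: "infdist u0 S\<phi> \<le> R / 4"
      and FE: "F u0 - F \<phi> \<le> E" and above: "\<forall>t>0. F \<phi> < F (u t)"
    interpret evi_trajectory W nW K F G u by (rule strong_solution_imp_evi_trajectory[OF sol])
    have u_0: "u 0 = u0" and cont: "continuous_on {0..} u" and inK: "\<And>t. 0 \<le> t \<Longrightarrow> u t \<in> K"
      using sol unfolding strong_solution_def by (auto simp: atLeast_def)
    have f: "F \<phi> < F (u t)" "F (u t) - F \<phi> \<le> E" if "0 < t" for t
      using above mono FE that by force+
    have "S\<phi> \<noteq> {}" using phi S\<phi>_def by blast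
    moreover have "infdist u0 S\<phi> < R / 2" using dist R by simp
    ultimately obtain \<psi> where \<psi>: "\<psi> \<in> S\<phi>" "norm (u0 - \<psi>) < R / 2"
      using cInf_lessD[of "dist u0 ` S\<phi>" "R / 2"] unfolding infdist_def dist_norm by auto
    have F\<psi>: "F \<psi> = F \<phi>" using \<psi> S\<phi>_def by simp
    have Loj': "(F (u t) - F \<phi>) powr (1 - \<gamma>) \<le> C * constrained_grad_norm K G (u t)"
      if "0 < t" "norm (u t - \<psi>) \<le> 3 * R / 4" for t
      using Loj[OF \<psi>(1), of "u t"] that f[OF that(1)] in_W in_K E F\<psi> R by (auto simp: R_def max_def)
    \<comment> \<open>The datum is closer than \<open>R / 2\<close> to \<open>\<psi>\<close> and the trajectory travels at most \<open>R / 4\<close>.\<close>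
    have stay: "norm (u t - \<psi>) < 3 * R / 4" if "0 \<le> t" for t
      by (rule stays_in_ball[OF C \<gamma> cont f Loj' _ that])
        (use \<psi> u_0 AE in \<open>auto simp: A_def\<close>)
    have Loj'': "(F (u t) - F \<phi>) powr (1 - \<gamma>) \<le> C * constrained_grad_norm K G (u t)" if "0 < t" for t
      using Loj'[OF that] stay[of t] that by simp
    have disp: "norm (u t - u s) \<le> A * (F (u s) - F \<phi>) powr \<gamma>" if "0 < s" "s \<le> t" for s t
      unfolding A_def by (rule displacement_le[OF C \<gamma> that]) (use f Loj'' that in auto)
    have decay1: "F (u t) - F \<phi> \<le> (k * t) powr (- (1 / m))" if "0 < t" "\<gamma> < 1/2" for t
      unfolding k_def m_def by (intro energy_decay(1)[where E=E, OF C \<gamma>] f Loj'' that)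
    have decay2: "F (u t) - F \<phi> \<le> E * exp (- (1 / (8 * C\<^sup>2) * t))" if "0 < t" "\<gamma> = 1/2" for t
      by (intro energy_decay(2)[where E=E, OF C \<gamma>] f Loj'' that)
    \<comment> \<open>Letting the end time tend to infinity, the length bound becomes the distance to the limit,
      provided that the energy tends to the critical level.\<close>
    have f0: "((\<lambda>t. F (u t) - F \<phi>) \<longlongrightarrow> 0) at_top"
    proof (cases "\<gamma> < 1/2")
      case True
      then have mk: "0 < m" "0 < k" using C by (auto simp: k_def m_def)
      show ?thesis
      proof (rule Lim_null_comparison)
        show "\<forall>\<^sub>F t in at_top. norm (F (u t) - F \<phi>) \<le> (k * t) powr (- (1 / m))"
          using eventually_gt_at_top[of 0]
        proof eventually_elim
          case (elim t)
          then show ?case using decay1[OF _ True] f(1)[OF elim] by simp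
        qed
        show "((\<lambda>t. (k * t) powr (- (1 / m))) \<longlongrightarrow> 0) at_top"
          by (rule tendsto_neg_powr)
            (use mk in \<open>auto intro!: filterlim_tendsto_pos_mult_at_top[OF tendsto_const] filterlim_ident\<close>)
      qed
    next
      case False
      then have g: "\<gamma> = 1/2" using \<gamma> by simp
      define q where "q = 1 / (8 * C\<^sup>2)"
      have q: "q > 0" using C by (simp add: q_def)
      show ?thesis
      proof (rule Lim_null_comparison)
        show "\<forall>\<^sub>F t in at_top. norm (F (u t) - F \<phi>) \<le> E * exp (- (q * t))"
          using eventually_gt_at_top[of 0]
        proof eventually_elim
          case (elim t)
          then show ?case using decay2[OF _ g] f(1)[OF elim] by (simp add: q_def)
        qed
        have "filterlim (\<lambda>t. - (q * t)) at_bot at_top"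
          unfolding filterlim_uminus_at_bot minus_minus
          by (rule filterlim_tendsto_pos_mult_at_top[OF tendsto_const q filterlim_ident])
        then have "((\<lambda>t. exp (- (q * t))) \<longlongrightarrow> 0) at_top"
          by (rule filterlim_compose[OF exp_at_bot])
        then show "((\<lambda>t. E * exp (- (q * t))) \<longlongrightarrow> 0) at_top"
          using tendsto_mult_right_zero by blast
      qed
    qed
    have "((\<lambda>t. (F (u t) - F \<phi>) powr \<gamma>) \<longlongrightarrow> 0 powr \<gamma>) at_top"
      by (rule tendsto_powr'[OF f0 tendsto_const]) (use \<gamma> f in \<open>auto intro!: eventually_at_top_linorderI[of 1] intro: less_imp_le\<close>)
    then have "((\<lambda>t. A * (F (u t) - F \<phi>) powr \<gamma>) \<longlongrightarrow> 0) at_top"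
      using tendsto_mult_right_zero by fastforce
    from converges_of_displacement_bound[of 1 u, OF disp this]
    obtain l where l: "(u \<longlongrightarrow> l) at_top" "\<And>s. 1 \<le> s \<Longrightarrow> norm (u s - l) \<le> A * (F (u s) - F \<phi>) powr \<gamma>"
      by (meson less_le_trans zero_less_one)
    have lK: "l \<in> K"
      by (rule Lim_in_closed_set[OF closed_K _ _ l(1)]) (use inK in \<open>auto intro!: eventually_at_top_linorderI[of 0]\<close>)
    have inN: "w \<in> N" if "w \<in> K" "norm (w - \<psi>) \<le> 3 * R / 4" for w
    proof (rule d(2)[OF that(1)])
      have "infdist w S\<phi> \<le> dist w \<psi>" by (rule infdist_le[OF \<psi>(1)])
      also have "\<dots> < R" using that R by (simp add: dist_norm)
      also have "\<dots> \<le> d" by (simp add: R_def)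
      finally show "infdist w S\<phi> < d" .
    qed
    have "norm (l - \<psi>) \<le> 3 * R / 4"
    proof (rule tendsto_upperbound)
      show "((\<lambda>t. norm (u t - \<psi>)) \<longlongrightarrow> norm (l - \<psi>)) at_top" by (intro tendsto_intros l)
      show "\<forall>\<^sub>F t in at_top. norm (u t - \<psi>) \<le> 3 * R / 4"
        using stay by (auto intro!: eventually_at_top_linorderI[of 0] less_imp_le)
    qed simp
    then have "l \<in> N \<inter> K" using inN lK by simp
    moreover have "\<forall>\<^sub>F t in at_top. u t \<in> N"
      using stay inK inN by (auto intro!: eventually_at_top_linorderI[of 0] less_imp_le)
    ultimately have lW: "l \<in> W"
      using limit_of_global_solution_in_W[OF a sol l(1)] by blast
    show "\<exists>u_inf\<in>W \<inter> K.
       (u \<longlongrightarrow> u_inf) at_top \<and>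
       (\<gamma> < 1/2 \<longrightarrow>
          (\<forall>t\<ge>1. norm (u t - u_inf) \<le> C' * t powr (- (\<gamma> / (1 - 2 * \<gamma>))) \<and>
                 F (u t) - F \<phi> \<le> C' * t powr (- (1 / (1 - 2 * \<gamma>))))) \<and>
       (\<gamma> = 1/2 \<longrightarrow>
          (\<forall>t\<ge>1. norm (u t - u_inf) \<le> exp (- C' * t) \<and>
                 F (u t) - F \<phi> \<le> exp (- C' * t)))"
    proof (intro bexI[of _ l] conjI allI impI l(1))
      fix t :: real assume g: "\<gamma> < 1/2" and t: "1 \<le> t"
      have t0: "0 < t" using t by simp
      have mk: "0 < m" "0 < k" using g C by (auto simp: k_def m_def)
      have D: "F (u t) - F \<phi> \<le> k powr (- (1 / m)) * t powr (- (1 / m))"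
        using decay1[OF t0 g] mk by (simp add: powr_mult)
      also have "\<dots> \<le> C' * t powr (- (1 / m))"
        by (rule mult_right_mono) (use g in \<open>auto simp: C'_def\<close>)
      finally show "F (u t) - F \<phi> \<le> C' * t powr (- (1 / (1 - 2 * \<gamma>)))" by (simp add: m_def)
      have "norm (u t - l) \<le> A * (F (u t) - F \<phi>) powr \<gamma>" by (rule l(2)[OF t])
      also have "\<dots> \<le> A * (k powr (- (1 / m)) * t powr (- (1 / m))) powr \<gamma>"
        using D f(1)[OF t0] A \<gamma> by (intro mult_left_mono powr_mono2) auto
      also have "\<dots> = A * k powr (- (\<gamma> / m)) * t powr (- (\<gamma> / m))"
        using mk t0 by (simp add: powr_mult powr_powr)
      also have "\<dots> \<le> C' * t powr (- (\<gamma> / m))"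
        by (rule mult_right_mono) (use g in \<open>auto simp: C'_def\<close>)
      finally show "norm (u t - l) \<le> C' * t powr (- (\<gamma> / (1 - 2 * \<gamma>)))" by (simp add: m_def)
    next
      fix t :: real assume g: "\<gamma> = 1/2" and t: "1 \<le> t"
      have t0: "0 < t" using t by simp
      have C'2: "1 / (8 * C\<^sup>2) = 2 * C'" using g by (simp add: C'_def)
      have D: "F (u t) - F \<phi> \<le> E * exp (- (2 * C' * t))"
        using decay2[OF t0 g] unfolding C'2 by simp
      also have "\<dots> \<le> 1 * exp (- C' * t)"
        by (rule mult_mono) (use E C' t0 in auto)
      finally show "F (u t) - F \<phi> \<le> exp (- C' * t)" by simp
      have "norm (u t - l) \<le> A * (F (u t) - F \<phi>) powr \<gamma>" by (rule l(2)[OF t])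
      also have "\<dots> \<le> A * (E * exp (- (2 * C' * t))) powr \<gamma>"
        using D f(1)[OF t0] A \<gamma> by (intro mult_left_mono powr_mono2) auto
      also have "\<dots> = A * E powr \<gamma> * exp (- C' * t)"
        using E g by (simp add: powr_mult exp_powr_real)
      also have "\<dots> \<le> 1 * exp (- C' * t)"
        by (rule mult_right_mono) (use AE in auto)
      finally show "norm (u t - l) \<le> exp (- C' * t)" by simp
    qed (use lW lK in auto)
  qed
qed

end
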